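(* Let $(m_n)_{n\ge1}$ be any sequence of integers all greater than $1$ and set $$\mu_n=\log m_n,\qquad t_n=\frac{3\log n}{2\mu_n}.$$ Then the family $\{(S_n,Q_{n,m_n},U_n)\}_{n\ge1}$ of $m_n$-shuffles presents a $(t_n,\mu_n^{-1})$ total variation cutoff.
   Context: Shuffles. $S_n$ is the set of arrangements of a deck of $n$ cards labelled $1,\dots,n$, identified with the symmetric group (an arrangement $\sigma$ lists cards $\sigma(1),\dots,\sigma(n)$ from top to bottom); $U_n$ is the uniform distribution on $S_n$. A rising sequence of $\sigma$ is a maximal set of cards with consecutive face values appearing in increasing order in $\sigma$; $r(\sigma)$ is the number of rising sequences, i.e. $1$ plus the number of $i\in\{1,\dots,n-1\}$ such that card $i+1$ appears before card $i$. For an integer $m\ge1$, an $m$-shuffle cuts the deck into $m$ packs of sizes $(a_1,\dots,a_m)$ with multinomial probability $m^{-n}\frac{n!}{a_1!\cdots a_m!}$, then drops cards one by one, from pack $i$ with probability proportional to its current size. Its distribution $Q_{n,m}$, started from a deck in order, is given by (Bayer–Diaconis) $Q_{n,m}(\sigma)=m^{-n}\binom{n+m-r(\sigma)}{n}$ (the binomial being $0$ if $m<r(\sigma)$), and this may be taken as the definition. For a probability $Q$ on $S_n$, $Q^k$ is the distribution after $k$ independent successive $Q$-shuffles from a deck in order, i.e. the $k$-fold convolution power of $Q$ on the symmetric group ($Q^0$ is the point mass at the identity). It is known that $Q_{n,m}*Q_{n,m'}=Q_{n,mm'}$. $\|\mu-\nu\|_{\mathrm{TV}}=\sup_{A}\{\mu(A)-\nu(A)\}$.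 Cutoff. For probabilities $Q_n$ on $S_n$, the family $\{(S_n,Q_n,U_n)\}$ presents a $(t_n,b_n)$ total variation cutoff if: (1) $t_n>0$ for all sufficiently large $n$ and $b_n/t_n\to0$; (2) for $c\neq0$, setting $k=k(n,c)=\lceil t_n+cb_n\rceil$ if $c>0$ and $k=\lfloor t_n+cb_n\rfloor$ if $c<0$ (non-negative for large $n$), the functions $\overline f(c)=\limsup_{n\to\infty}\|Q_n^{k}-U_n\|_{\mathrm{TV}}$ and $\underline f(c)=\liminf_{n\to\infty}\|Q_n^{k}-U_n\|_{\mathrm{TV}}$ satisfy $\lim_{c\to\infty}\overline f(c)=0$ and $\lim_{c\to-\infty}\underline f(c)=1$. (By group invariance the starting arrangement is irrelevant.) *)

theory Defs
  imports
    "HOL-Probability.Probability"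
    "HOL-Combinatorics.Permutations"
begin

(* An arrangement of the deck is a permutation \<sigma> of {1..n}; \<sigma> i is the label of the card
   in position i from the top, so inv \<sigma> c is the position of card c. *)

definition rising_sequences :: "nat \<Rightarrow> (nat \<Rightarrow> nat) \<Rightarrow> nat"
  where "rising_sequences n \<sigma> = 1 + card {i \<in> {1..<n}. inv \<sigma> (i + 1) < inv \<sigma> i}"

definition shuffle_weight :: "nat \<Rightarrow> nat \<Rightarrow> (nat \<Rightarrow> nat) \<Rightarrow> real"
  where "shuffle_weight n m \<sigma> =
    (if \<sigma> permutes {1..n}
     then real ((n + m - rising_sequences n \<sigma>) choose n) / real m ^ n else 0)"

(* Meaningful for m \<ge> 1; see pmf_riffle_shuffle below for well-definedness. In the
   Bayer-Diaconis formula the truncated subtraction is harmless: rising_sequences n \<sigma> \<le> n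
   when n \<ge> 1, and the binomial coefficient vanishes when m < rising_sequences n \<sigma>. *)
definition riffle_shuffle :: "nat \<Rightarrow> nat \<Rightarrow> (nat \<Rightarrow> nat) pmf"
  where "riffle_shuffle n m = embed_pmf (shuffle_weight n m)"

definition uniform_perm :: "nat \<Rightarrow> (nat \<Rightarrow> nat) pmf"
  where "uniform_perm n = pmf_of_set {\<sigma>. \<sigma> permutes {1..n}}"

definition perm_convolution ::
    "('a \<Rightarrow> 'a) pmf \<Rightarrow> ('a \<Rightarrow> 'a) pmf \<Rightarrow> ('a \<Rightarrow> 'a) pmf"
  where "perm_convolution P Q = map_pmf (\<lambda>(\<sigma>, \<tau>). \<sigma> \<circ> \<tau>) (pair_pmf P Q)"

(* Reversing the order of multiplication in the group does not change convolution powers. *)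
definition convolution_power :: "('a \<Rightarrow> 'a) pmf \<Rightarrow> nat \<Rightarrow> ('a \<Rightarrow> 'a) pmf"
  where "convolution_power Q k = (perm_convolution Q ^^ k) (return_pmf id)"

definition tv_dist :: "'a pmf \<Rightarrow> 'a pmf \<Rightarrow> real"
  where "tv_dist P Q = (SUP A. measure_pmf.prob P A - measure_pmf.prob Q A)"

(* The value at c = 0 is irrelevant. *)
definition cutoff_time :: "real \<Rightarrow> real \<Rightarrow> real \<Rightarrow> nat"
  where "cutoff_time t b c = (if c > 0 then nat \<lceil>t + c * b\<rceil> else nat \<lfloor>t + c * b\<rfloor>)"

(* Total variation cutoff for the family (S_n, Q n, U_n). The first two conditions make
   t n + c * b n non-negative for all large n, so the truncation by nat in cutoff_time does not
   affect the limits. *)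
definition presents_tv_cutoff ::
    "(nat \<Rightarrow> (nat \<Rightarrow> nat) pmf) \<Rightarrow> (nat \<Rightarrow> real) \<Rightarrow> (nat \<Rightarrow> real) \<Rightarrow> bool"
  where "presents_tv_cutoff Q t b \<longleftrightarrow>
    (\<forall>\<^sub>F n in sequentially. t n > 0) \<and>
    (\<lambda>n. b n / t n) \<longlonglongrightarrow> 0 \<and>
    ((\<lambda>c. limsup (\<lambda>n. ereal
        (tv_dist (convolution_power (Q n) (cutoff_time (t n) (b n) c)) (uniform_perm n))))
      \<longlongrightarrow> 0) at_top \<and>
    ((\<lambda>c. liminf (\<lambda>n. ereal
        (tv_dist (convolution_power (Q n) (cutoff_time (t n) (b n) c)) (uniform_perm n))))
      \<longlongrightarrow> 1) at_bot"


(* The remaining lemmas show that the Bayer-Diaconis weights sum to 1 (Worpitzky's identity), so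
   that riffle_shuffle is well defined. *)

lemma increasing_steps:
  fixes h :: "nat \<Rightarrow> nat"
  assumes "\<forall>i\<in>{1..<n}. h i < h (i + 1)"
  shows "strict_mono_on {1..n} h"
proof (rule strict_mono_onI)
  fix i j assume "i \<in> {1..n}" "j \<in> {1..n}" "i < j"
  have "j \<le> n \<longrightarrow> h i < h j" using \<open>i < j\<close>
  proof (induction j)
    case (Suc j)
    show ?case
    proof
      assume "Suc j \<le> n"
      then have *: "1 \<le> j \<Longrightarrow> h j < h (Suc j)" using assms by auto
      show "h i < h (Suc j)"
        using Suc * \<open>Suc j \<le> n\<close> \<open>i \<in> _\<close>
        by (metis Suc_leD Suc_leI atLeastAtMost_iff less_Suc_eq less_trans not_less_eq_eq One_nat_def le_trans less_imp_le)
    qed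
  qed simp
  then show "h i < h j" using \<open>j \<in> _\<close> by auto
qed

lemma increasing_enum_unique:
  fixes h h' :: "nat \<Rightarrow> nat"
  assumes h: "strict_mono_on {1..n} h" and h': "strict_mono_on {1..n} h'"
    and im: "h ` {1..n} = h' ` {1..n}" and i: "i \<in> {1..n}"
  shows "h i = h' i"
proof -
  have *: "card {b \<in> g ` {1..n}. b \<le> g k} = k"
    if g: "strict_mono_on {1..n} g" and k: "k \<in> {1..n}" for g :: "nat \<Rightarrow> nat" and k
  proof -
    have "{b \<in> g ` {1..n}. b \<le> g k} = g ` {1..k}"
      using k by (auto simp: strict_mono_on_less_eq[OF g])
    moreover have "inj_on g {1..k}"
      using strict_mono_on_imp_inj_on[OF g] by (rule inj_on_subset) (use k in auto)
    ultimately show ?thesis by (simp add: card_image)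
  qed
  from i im obtain j where j: "j \<in> {1..n}" "h i = h' j" by (metis imageE imageI)
  have "i = j" using *[OF h i] *[OF h' j(1)] im j(2) by simp
  with j show ?thesis by simp
qed

lemma increasing_enum_exists:
  fixes B :: "nat set"
  assumes "finite B" "card B = n"
  obtains h where "strict_mono_on {1..n} h" "h ` {1..n} = B"
proof -
  obtain g where g: "bij_betw g {..<card B} B" "strict_mono_on {..<card B} g"
    using ex_bij_betw_strict_mono_card[OF assms(1)] by blast
  have eq: "(\<lambda>i. i - 1) ` {1..n} = {..<n}"
    by (force simp: image_iff intro: bexI[of _ "Suc _"])
  show thesis
  proof (rule that[of "\<lambda>i. g (i - 1)"])
    show "strict_mono_on {1..n} (\<lambda>i. g (i - 1))"
      by (rule strict_mono_onI, rule strict_mono_onD[OF g(2)]) (use assms in auto)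
    have "(\<lambda>i. g (i - 1)) ` {1..n} = g ` {..<n}"
      unfolding eq[symmetric] image_image ..
    then show "(\<lambda>i. g (i - 1)) ` {1..n} = B"
      using g(1) assms by (simp add: bij_betw_def)
  qed
qed

(* The inverse shuffle: position p of the deck receives the pack label f p, and stably sorting the
   positions by label lists them in the order \<tau> 1, ..., \<tau> n. *)
definition labelled_by :: "nat \<Rightarrow> (nat \<Rightarrow> nat) \<Rightarrow> (nat \<Rightarrow> nat) \<Rightarrow> bool"
  where "labelled_by n \<tau> f \<longleftrightarrow>
    (\<forall>i\<in>{1..<n}. f (\<tau> i) < f (\<tau> (i + 1)) \<or> f (\<tau> i) = f (\<tau> (i + 1)) \<and> \<tau> i < \<tau> (i + 1))"

lemma card_labelled_by:
  assumes \<tau>: "\<tau> permutes {1..n}" and m: "m > 0"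
  shows "card {f \<in> {1..n} \<rightarrow>\<^sub>E {..<m}. labelled_by n \<tau> f} =
    (n + m - (1 + card {i \<in> {1..<n}. \<tau> (i + 1) < \<tau> i})) choose n"
proof (cases "n = 0")
  case True
  then show ?thesis using m by (simp add: labelled_by_def)
next
  case n: False
  define d where "d i = card {j \<in> {1..<i}. \<tau> (j + 1) < \<tau> j}" for i
  define N where "N = n + m - (1 + d n)"
  define H where "H f i = f (\<tau> i) + (i - 1 - d i)" for f i
  have d_le: "d i \<le> i - 1" for i
  proof -
    have "d i \<le> card {1..<i}" unfolding d_def by (rule card_mono) auto
    then show ?thesis by simp
  qed
  have d_Suc: "d (i + 1) = d i + (if \<tau> (i + 1) < \<tau> i then 1 else 0)" if "i \<ge> 1" for i
  proof -
    have "{j \<in> {1..<i + 1}. \<tau> (j + 1) < \<tau> j} =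
        (if \<tau> (i + 1) < \<tau> i then insert i {j \<in> {1..<i}. \<tau> (j + 1) < \<tau> j}
         else {j \<in> {1..<i}. \<tau> (j + 1) < \<tau> j})"
      using that by (auto simp: less_Suc_eq)
    then show ?thesis unfolding d_def by simp
  qed
  have d_mono: "d i \<le> d j" if "i \<le> j" for i j
    unfolding d_def by (rule card_mono) (use that in auto)
  have \<tau>_in: "\<tau> i \<in> {1..n} \<longleftrightarrow> i \<in> {1..n}" for i by (rule permutes_in_image[OF \<tau>])
  have \<tau>_ne: "\<tau> (i + 1) \<noteq> \<tau> i" for i
    using injD[OF permutes_inj[OF \<tau>], of "i + 1" i] by auto
  have H_step: "H f i < H f (i + 1)"
    if "i \<in> {1..<n}"
      "f (\<tau> i) < f (\<tau> (i + 1)) \<or> f (\<tau> i) = f (\<tau> (i + 1)) \<and> \<tau> i < \<tau> (i + 1)" for f i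
  proof -
    have i: "i \<ge> 1" using that by simp
    show ?thesis
    proof (cases "\<tau> (i + 1) < \<tau> i")
      case True
      then have "d (i + 1) = d i + 1" "f (\<tau> i) < f (\<tau> (i + 1))" using d_Suc[OF i] that by auto
      then show ?thesis using d_le[of "i + 1"] i unfolding H_def by linarith
    next
      case False
      then have "d (i + 1) = d i" "f (\<tau> i) \<le> f (\<tau> (i + 1))" using d_Suc[OF i] that by auto
      then show ?thesis using d_le[of i] i unfolding H_def by linarith
    qed
  qed
  have H_mono: "strict_mono_on {1..n} (H f)" if "labelled_by n \<tau> f" for f
    by (rule increasing_steps, rule ballI, rule H_step, assumption)
      (use that in \<open>simp add: labelled_by_def\<close>)
  have gap: "h i + (j - i) \<le> h j"
    if h: "strict_mono_on {1..n} h" and "1 \<le> i" "i \<le> j" "j \<le> n" for h :: "nat \<Rightarrow> nat" and i j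
    using \<open>i \<le> j\<close> \<open>j \<le> n\<close>
  proof (induction j rule: dec_induct)
    case (step j)
    then have "h j < h (Suc j)" using h \<open>1 \<le> i\<close> by (auto intro!: strict_mono_onD[OF h])
    with step show ?case by auto
  qed simp
  have "bij_betw (\<lambda>f. H f ` {1..n}) {f \<in> {1..n} \<rightarrow>\<^sub>E {..<m}. labelled_by n \<tau> f}
      {B. B \<subseteq> {..<N} \<and> card B = n}"
  proof (rule bij_betwI')
    fix f g
    assume "f \<in> {f \<in> {1..n} \<rightarrow>\<^sub>E {..<m}. labelled_by n \<tau> f}"
      and "g \<in> {f \<in> {1..n} \<rightarrow>\<^sub>E {..<m}. labelled_by n \<tau> f}"
    then have f: "f \<in> {1..n} \<rightarrow>\<^sub>E {..<m}" "labelled_by n \<tau> f"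
      and g: "g \<in> {1..n} \<rightarrow>\<^sub>E {..<m}" "labelled_by n \<tau> g" by auto
    show "(H f ` {1..n} = H g ` {1..n}) = (f = g)"
    proof
      assume im: "H f ` {1..n} = H g ` {1..n}"
      have "f (\<tau> i) = g (\<tau> i)" if "i \<in> {1..n}" for i
        using increasing_enum_unique[OF H_mono[OF f(2)] H_mono[OF g(2)] im that]
        by (simp add: H_def)
      then have "f p = g p" if "p \<in> {1..n}" for p
        using that permutes_image[OF \<tau>] by (metis imageE)
      then show "f = g" using f g by (intro PiE_ext[of f _ _ g]) auto
    qed simp
  next
    fix f
    assume "f \<in> {f \<in> {1..n} \<rightarrow>\<^sub>E {..<m}. labelled_by n \<tau> f}"
    then have f: "f \<in> {1..n} \<rightarrow>\<^sub>E {..<m}" "labelled_by n \<tau> f" by auto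
    have "H f i < N" if "i \<in> {1..n}" for i
    proof -
      have "H f i \<le> H f n"
        using gap[OF H_mono[OF f(2)], of i n] that by auto
      moreover have "f (\<tau> n) < m" using f \<tau>_in[of n] n by (auto simp: PiE_iff)
      ultimately show ?thesis using d_le[of n] n by (auto simp: H_def N_def)
    qed
    moreover have "card (H f ` {1..n}) = n"
      using card_image[OF strict_mono_on_imp_inj_on[OF H_mono[OF f(2)]]] by simp
    ultimately show "H f ` {1..n} \<in> {B. B \<subseteq> {..<N} \<and> card B = n}" by auto
  next
    fix B
    assume "B \<in> {B. B \<subseteq> {..<N} \<and> card B = n}"
    then have B: "B \<subseteq> {..<N}" "card B = n" by auto
    then have "finite B" by (meson finite_lessThan finite_subset)
    then obtain h where h: "strict_mono_on {1..n} h" "h ` {1..n} = B"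
      using B by (metis increasing_enum_exists)
    define f where "f = restrict (\<lambda>p. h (inv \<tau> p) + d (inv \<tau> p) + 1 - inv \<tau> p) {1..n}"
    have f_\<tau>: "f (\<tau> i) = h i + d i + 1 - i" if "i \<in> {1..n}" for i
      using that \<tau>_in[of i] permutes_inverses[OF \<tau>] by (simp add: f_def)
    have h_ge: "h i + 1 \<ge> i" if "i \<in> {1..n}" for i
      using gap[OF h(1), of 1 i] that by auto
    have H_f: "H f i = h i" if "i \<in> {1..n}" for i
      using h_ge[OF that] d_le[of i] that
      unfolding H_def f_\<tau>[OF that] atLeastAtMost_iff by linarith
    have "f (\<tau> i) < m" if i: "i \<in> {1..n}" for i
    proof -
      have "h n < N" using B h n by auto
      moreover have "h i + (n - i) \<le> h n" using gap[OF h(1), of i n] i by auto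
      moreover have "d i \<le> d n" using d_mono i by auto
      ultimately show ?thesis
        using i h_ge[OF i] d_le[of n] by (auto simp: f_\<tau> N_def)
    qed
    then have "f p < m" if "p \<in> {1..n}" for p
      using that permutes_image[OF \<tau>] by (metis imageE)
    then have "f \<in> {1..n} \<rightarrow>\<^sub>E {..<m}" by (auto simp: f_def)
    moreover have "labelled_by n \<tau> f"
      unfolding labelled_by_def
    proof
      fix i assume i: "i \<in> {1..<n}"
      then have "h i < h (i + 1)" by (auto intro!: strict_mono_onD[OF h(1)])
      then show "f (\<tau> i) < f (\<tau> (i + 1)) \<or> f (\<tau> i) = f (\<tau> (i + 1)) \<and> \<tau> i < \<tau> (i + 1)"
        using i f_\<tau>[of i] f_\<tau>[of "i + 1"] d_Suc[of i] h_ge[of i] \<tau>_ne[of i]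
        by (auto split: if_splits)
    qed
    moreover have "H f ` {1..n} = B" using H_f h(2) by (metis image_cong)
    ultimately show "\<exists>f\<in>{f \<in> {1..n} \<rightarrow>\<^sub>E {..<m}. labelled_by n \<tau> f}. B = H f ` {1..n}"
      by blast
  qed
  then have "card {f \<in> {1..n} \<rightarrow>\<^sub>E {..<m}. labelled_by n \<tau> f} =
      card {B. B \<subseteq> {..<N} \<and> card B = n}" by (rule bij_betw_same_card)
  also have "\<dots> = N choose n" using n_subsets[of "{..<N}" n] by simp
  finally show ?thesis by (simp add: N_def d_def)
qed

lemma ex1_labelled_by: "\<exists>!\<tau>. \<tau> permutes {1..n} \<and> labelled_by n \<tau> f"
proof -
  define key where "key p = f p * (n + 1) + p" for p
  have key: "key p < key q \<longleftrightarrow> f p < f q \<or> f p = f q \<and> p < q"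
    if "p \<in> {1..n}" "q \<in> {1..n}" for p q
  proof -
    have *: "key p < key q" if "f p < f q" "p \<in> {1..n}" for p q
    proof -
      have "(f p + 1) * (n + 1) \<le> f q * (n + 1)" using that by (intro mult_right_mono) auto
      then show ?thesis using that by (auto simp: key_def)
    qed
    show ?thesis using *[of p q] *[of q p] that
      by (cases "f p" "f q" rule: linorder_cases) (auto simp: key_def)
  qed
  have lab: "labelled_by n \<tau> f \<longleftrightarrow> strict_mono_on {1..n} (key \<circ> \<tau>)" if \<tau>: "\<tau> permutes {1..n}" for \<tau>
  proof -
    have \<tau>_in: "\<tau> i \<in> {1..n} \<longleftrightarrow> i \<in> {1..n}" for i by (rule permutes_in_image[OF \<tau>])
    have "labelled_by n \<tau> f \<longleftrightarrow> (\<forall>i\<in>{1..<n}. (key \<circ> \<tau>) i < (key \<circ> \<tau>) (i + 1))"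
      unfolding labelled_by_def o_def
      by (intro ball_cong refl, subst key) (use \<tau>_in in auto)
    also have "\<dots> \<longleftrightarrow> strict_mono_on {1..n} (key \<circ> \<tau>)"
      by (intro iffI increasing_steps) (auto simp: strict_mono_on_def)
    finally show ?thesis .
  qed
  have inj: "inj_on key {1..n}"
    by (rule inj_onI) (metis key less_irrefl linorder_neqE_nat)
  have "card (key ` {1..n}) = n" using inj by (simp add: card_image)
  then obtain h where h: "strict_mono_on {1..n} h" "h ` {1..n} = key ` {1..n}"
    by (metis increasing_enum_exists finite_imageI finite_atLeastAtMost)
  show ?thesis
  proof (rule ex_ex1I)
    define \<tau> where "\<tau> i = (if i \<in> {1..n} then the_inv_into {1..n} key (h i) else i)" for i
    have \<tau>: "\<tau> permutes {1..n}"
    proof (rule bij_imp_permutes)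
      have "bij_betw h {1..n} (key ` {1..n})"
        using h strict_mono_on_imp_inj_on by (auto simp: bij_betw_def)
      moreover have "bij_betw (the_inv_into {1..n} key) (key ` {1..n}) {1..n}"
        using inj by (simp add: bij_betw_the_inv_into bij_betw_imageI)
      ultimately have "bij_betw (the_inv_into {1..n} key \<circ> h) {1..n} {1..n}"
        by (rule bij_betw_trans)
      then show "bij_betw \<tau> {1..n} {1..n}"
        by (subst bij_betw_cong[of _ _ "the_inv_into {1..n} key \<circ> h"]) (auto simp: \<tau>_def)
    qed (auto simp: \<tau>_def)
    have "key (\<tau> i) = h i" if "i \<in> {1..n}" for i
    proof -
      have "h i \<in> key ` {1..n}" using that h(2) by blast
      then show ?thesis using that inj by (simp add: \<tau>_def f_the_inv_into_f)
    qed
    then have "strict_mono_on {1..n} (key \<circ> \<tau>)"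
      using h(1) by (simp add: strict_mono_on_def)
    with \<tau> lab show "\<exists>\<tau>. \<tau> permutes {1..n} \<and> labelled_by n \<tau> f" by blast
  next
    fix \<tau> \<rho>
    assume "\<tau> permutes {1..n} \<and> labelled_by n \<tau> f" "\<rho> permutes {1..n} \<and> labelled_by n \<rho> f"
    then have \<tau>: "\<tau> permutes {1..n}" "strict_mono_on {1..n} (key \<circ> \<tau>)"
      and \<rho>: "\<rho> permutes {1..n}" "strict_mono_on {1..n} (key \<circ> \<rho>)" using lab by auto
    have im: "(key \<circ> \<tau>) ` {1..n} = (key \<circ> \<rho>) ` {1..n}"
      by (simp only: image_comp[symmetric] permutes_image[OF \<tau>(1)] permutes_image[OF \<rho>(1)])
    show "\<tau> = \<rho>"
    proof
      fix i
      show "\<tau> i = \<rho> i"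
      proof (cases "i \<in> {1..n}")
        case True
        then have "key (\<tau> i) = key (\<rho> i)"
          using increasing_enum_unique[OF \<tau>(2) \<rho>(2) im] by simp
        then show ?thesis
          using inj True permutes_in_image[OF \<tau>(1)] permutes_in_image[OF \<rho>(1)]
          by (auto dest: inj_onD)
      next
        case False
        then show ?thesis using \<tau>(1) \<rho>(1) by (metis permutes_not_in)
      qed
    qed
  qed
qed

lemma sum_choose_rising_sequences:
  assumes "m > 0"
  shows "(\<Sum>\<sigma> | \<sigma> permutes {1..n}. (n + m - rising_sequences n \<sigma>) choose n) = m ^ n"
proof -
  let ?F = "{1..n} \<rightarrow>\<^sub>E {..<m}" and ?S = "{\<tau>. \<tau> permutes {1..n}}"
  have fin: "finite ?F" "finite ?S" by (auto intro: finite_PiE finite_permutations)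
  have "(\<Sum>\<sigma>\<in>?S. (n + m - rising_sequences n \<sigma>) choose n) =
      (\<Sum>\<tau>\<in>?S. (n + m - rising_sequences n (inv \<tau>)) choose n)"
    by (rule sum_permutations_inverse)
  also have "\<dots> = (\<Sum>\<tau>\<in>?S. card {f \<in> ?F. labelled_by n \<tau> f})"
  proof (intro sum.cong refl)
    fix \<tau> assume "\<tau> \<in> ?S"
    then have \<tau>: "\<tau> permutes {1..n}" by simp
    show "(n + m - rising_sequences n (inv \<tau>)) choose n = card {f \<in> ?F. labelled_by n \<tau> f}"
      unfolding card_labelled_by[OF \<tau> assms] rising_sequences_def permutes_inv_inv[OF \<tau>] ..
  qed
  also have "\<dots> = (\<Sum>\<tau>\<in>?S. \<Sum>f\<in>?F. if labelled_by n \<tau> f then 1 else 0)"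
    using fin by (intro sum.cong refl) (simp add: sum.If_cases Int_def)
  also have "\<dots> = (\<Sum>f\<in>?F. \<Sum>\<tau>\<in>?S. if labelled_by n \<tau> f then 1 else 0)"
    by (rule sum.swap)
  also have "\<dots> = (\<Sum>f\<in>?F. 1)"
  proof (intro sum.cong refl)
    fix f
    obtain \<tau> where "{\<tau> \<in> ?S. labelled_by n \<tau> f} = {\<tau>}"
      using ex1_labelled_by[of n f] by (auto simp: set_eq_iff)
    moreover have "(\<Sum>\<tau>\<in>?S. if labelled_by n \<tau> f then 1 else 0) =
        card {\<tau> \<in> ?S. labelled_by n \<tau> f}"
      using fin by (simp add: sum.If_cases Int_def)
    ultimately show "(\<Sum>\<tau>\<in>?S. if labelled_by n \<tau> f then 1 else 0) = (1::nat)" by simp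
  qed
  also have "\<dots> = m ^ n" by (simp add: card_PiE)
  finally show ?thesis .
qed

lemma pmf_riffle_shuffle:
  assumes "m > 0"
  shows "pmf (riffle_shuffle n m) \<sigma> = shuffle_weight n m \<sigma>"
  unfolding riffle_shuffle_def
proof (rule pmf_embed_pmf)
  let ?S = "{\<tau>. \<tau> permutes {1..n}}"
  show nonneg: "0 \<le> shuffle_weight n m \<sigma>" for \<sigma> by (simp add: shuffle_weight_def)
  have fin: "finite ?S" by (rule finite_permutations) simp
  have "(\<integral>\<^sup>+ \<sigma>. ennreal (shuffle_weight n m \<sigma>) \<partial>count_space UNIV) =
      (\<Sum>\<sigma>\<in>?S. ennreal (shuffle_weight n m \<sigma>))"
    by (rule nn_integral_count_space') (use fin in \<open>auto simp: shuffle_weight_def\<close>)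
  also have "\<dots> = ennreal (\<Sum>\<sigma>\<in>?S. shuffle_weight n m \<sigma>)"
    using nonneg by (simp add: sum_ennreal)
  also have "(\<Sum>\<sigma>\<in>?S. shuffle_weight n m \<sigma>) =
      real (\<Sum>\<sigma>\<in>?S. (n + m - rising_sequences n \<sigma>) choose n) / real m ^ n"
    by (simp add: shuffle_weight_def sum_divide_distrib)
  also have "\<dots> = 1"
    unfolding sum_choose_rising_sequences[OF assms] using assms by simp
  finally show "(\<integral>\<^sup>+ \<sigma>. ennreal (shuffle_weight n m \<sigma>) \<partial>count_space UNIV) = 1" by simp
qed

end

theory Submission
  imports Defs "HOL-Real_Asymp.Real_Asymp"
begin

text \<open>
  The \<open>k\<close>-th convolution power of an \<open>m\<close>-shuffle is the \<open>m ^ k\<close>-shuffle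
  (\<open>convolution_power_riffle_shuffle\<close>), because two successive stable sorts by independent uniform
  labels are one stable sort by the two-digit label. So everything depends on how far the shuffle
  with \<open>M\<close> packs is from uniform, and the claim is that the change happens when \<open>M\<close> is of order
  \<open>n * sqrt n\<close>, with a window of constant factors: \<open>m n ^ k = exp c * n * sqrt n\<close> is the equation
  \<open>k = t n + c / \<mu> n\<close>.

  Relative to the uniform distribution, an arrangement with \<open>r \<le> M\<close> rising sequences has density
  \<open>\<Prod>j=1..n. 1 + (j - r) / M\<close>. The logarithm of this product is, roughly,
  \<open>n * h / M\<close> minus a multiple of \<open>n ^ 3 / M ^ 2\<close>, where \<open>h = (n + 1) / 2 - r\<close>. Under the
  uniform distribution \<open>h\<close> is of order \<open>sqrt n\<close>: it is half a sum of signs that are uncorrelated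
  unless their indices are adjacent (\<open>sum_rising_deficit_squared\<close>), and Chebyshev's inequality applies.
  Both terms are thus governed by \<open>y = n * sqrt n / M\<close>, as \<open>K * y\<close> and \<open>y ^ 2\<close> with \<open>K\<close> the size of
  \<open>h / sqrt n\<close>.

  If \<open>y\<close> is small the density is not much below 1 on most arrangements, and this alone bounds
  the total variation distance (\<open>tv_dist_above_cutoff\<close>). If \<open>y\<close> is large the quadratic term dominates
  and the density is close to 0 on most arrangements, so the shuffle and the uniform distribution live
  on almost disjoint sets (\<open>tv_dist_below_cutoff\<close>). Working with densities on a set of large uniform
  probability avoids any estimate of moments under the shuffle itself.
\<close>

section \<open>Composition of riffle shuffles\<close>

lemma labelled_by_less:
  assumes lab: "labelled_by n \<tau> f" and "1 \<le> i" "i < j" "j \<le> n"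
  shows "f (\<tau> i) < f (\<tau> j) \<or> f (\<tau> i) = f (\<tau> j) \<and> \<tau> i < \<tau> j"
  using \<open>i < j\<close> \<open>j \<le> n\<close>
proof (induction j)
  case (Suc j)
  show ?case
  proof (cases "i = j")
    case True
    then show ?thesis using lab Suc.prems \<open>1 \<le> i\<close> by (auto simp: labelled_by_def)
  next
    case False
    then have "f (\<tau> i) < f (\<tau> j) \<or> f (\<tau> i) = f (\<tau> j) \<and> \<tau> i < \<tau> j"
      using Suc by simp
    moreover have "f (\<tau> j) < f (\<tau> (j + 1)) \<or> f (\<tau> j) = f (\<tau> (j + 1)) \<and> \<tau> j < \<tau> (j + 1)"
      using lab Suc.prems \<open>1 \<le> i\<close> False by (auto simp: labelled_by_def)
    ultimately show ?thesis by auto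
  qed
qed simp

text \<open>
  The inverse of a riffle shuffle gives every position an independent uniform pack label and
  then sorts stably. This is the permutation that performs the sort; it exists and is unique
  because ties are broken by position.
\<close>

definition sorting_perm :: "nat \<Rightarrow> (nat \<Rightarrow> nat) \<Rightarrow> nat \<Rightarrow> nat"
  where "sorting_perm n f = (THE \<tau>. \<tau> permutes {1..n} \<and> labelled_by n \<tau> f)"

lemma sorting_perm:
  shows sorting_perm_permutes: "sorting_perm n f permutes {1..n}"
    and labelled_by_sorting_perm: "labelled_by n (sorting_perm n f) f"
  using theI'[OF ex1_labelled_by[of n f]] by (simp_all add: sorting_perm_def)

lemma sorting_perm_eqI:
  assumes "\<tau> permutes {1..n}" "labelled_by n \<tau> f"
  shows "sorting_perm n f = \<tau>"
  using ex1_labelled_by[of n f] assms sorting_perm[of n f] by blast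

abbreviation labellings :: "nat \<Rightarrow> nat \<Rightarrow> (nat \<Rightarrow> nat) set"
  where "labellings n m \<equiv> {1..n} \<rightarrow>\<^sub>E {..<m}"

lemma finite_labellings: "finite (labellings n m)"
  by (intro finite_PiE) auto

lemma labellings_nonempty: "m > 0 \<Longrightarrow> labellings n m \<noteq> {}"
  by (auto simp: PiE_eq_empty_iff)

text \<open>
  The Bayer-Diaconis weight of \<open>\<sigma>\<close> counts the labellings whose stable sort is the inverse of
  \<open>\<sigma>\<close>. In this form a riffle shuffle is the image of a uniform choice, which turns convolution
  identities into bijections between sets of labellings.
\<close>

lemma riffle_shuffle_eq_sorting:
  assumes m: "m > 0"
  shows "riffle_shuffle n m =
    map_pmf (\<lambda>f. inv (sorting_perm n f)) (pmf_of_set (labellings n m))"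
proof (rule pmf_eqI)
  fix \<sigma>
  let ?h = "\<lambda>f. inv (sorting_perm n f)"
  note A = finite_labellings[of n m] labellings_nonempty[OF m, of n]
  have "pmf (map_pmf ?h (pmf_of_set (labellings n m))) \<sigma> =
      real (card {f \<in> labellings n m. ?h f = \<sigma>}) / real m ^ n"
    using A by (simp add: pmf_map measure_pmf_of_set card_PiE vimage_def Int_def)
  also have "\<dots> = shuffle_weight n m \<sigma>"
  proof (cases "\<sigma> permutes {1..n}")
    case True
    have "?h f = \<sigma> \<longleftrightarrow> labelled_by n (inv \<sigma>) f" for f
      using sorting_perm[of n f] sorting_perm_eqI[OF permutes_inv[OF True], of f]
        permutes_inv_inv[OF True] permutes_inv_inv[OF sorting_perm_permutes, of n f] by metis
    then have "{f \<in> labellings n m. ?h f = \<sigma>} = {f \<in> labellings n m. labelled_by n (inv \<sigma>) f}"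
      by simp
    then show ?thesis
      using card_labelled_by[OF permutes_inv[OF True] m] True
      by (simp add: shuffle_weight_def rising_sequences_def)
  next
    case False
    then have none: "{f \<in> labellings n m. ?h f = \<sigma>} = {}"
      using permutes_inv[OF sorting_perm_permutes] by blast
    from False show ?thesis unfolding none by (simp add: shuffle_weight_def)
  qed
  finally show "pmf (riffle_shuffle n m) \<sigma> =
      pmf (map_pmf ?h (pmf_of_set (labellings n m))) \<sigma>"
    by (simp add: pmf_riffle_shuffle[OF m])
qed

text \<open>
  Two successive sorts, first by \<open>f'\<close> and then by \<open>f\<close>, amount to one sort by a two-digit label. The
  second sort acts on the deck already rearranged by \<open>f'\<close>, so its digit is read at the position
  to which the first sort moved \<open>p\<close>; being applied last, it is the leading digit.
\<close>

definition refine_labels :: "nat \<Rightarrow> nat \<Rightarrow> (nat \<Rightarrow> nat) \<Rightarrow> (nat \<Rightarrow> nat) \<Rightarrow> nat \<Rightarrow> nat"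
  where "refine_labels n m' f f' =
    restrict (\<lambda>p. f (inv (sorting_perm n f') p) * m' + f' p) {1..n}"

lemma two_digit_less_iff:
  fixes a b c d m :: nat
  assumes "c < m" "d < m"
  shows "a * m + c < b * m + d \<longleftrightarrow> a < b \<or> a = b \<and> c < d"
proof -
  have *: "a * m + c < b * m + d" if "a < b" "c < m" for a b c d :: nat
  proof -
    have "(a + 1) * m \<le> b * m" using that by (intro mult_right_mono) auto
    then show ?thesis using that by auto
  qed
  show ?thesis
    using *[of a b c d] *[of b a d c] assms by (cases a b rule: linorder_cases) auto
qed

text \<open>
  When two cards agree in the leading digit \<open>f\<close>, the outer sort keeps the order produced by the
  inner one, and that order compares \<open>f'\<close> and then the original positions. This is exactly the
  comparison of two-digit labels with ties broken by position.
\<close>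

lemma sorting_perm_refine_labels:
  assumes f: "f \<in> labellings n m" and f': "f' \<in> labellings n m'"
  shows "sorting_perm n (refine_labels n m' f f') = sorting_perm n f' \<circ> sorting_perm n f"
proof (rule sorting_perm_eqI)
  let ?\<tau> = "sorting_perm n f" and ?\<tau>' = "sorting_perm n f'"
  show "?\<tau>' \<circ> ?\<tau> permutes {1..n}"
    by (intro permutes_compose sorting_perm_permutes)
  have \<tau>_in: "?\<tau> i \<in> {1..n} \<longleftrightarrow> i \<in> {1..n}" for i
    by (rule permutes_in_image[OF sorting_perm_permutes])
  have \<tau>'_in: "?\<tau>' i \<in> {1..n} \<longleftrightarrow> i \<in> {1..n}" for i
    by (rule permutes_in_image[OF sorting_perm_permutes])
  have val: "refine_labels n m' f f' (?\<tau>' q) = f q * m' + f' (?\<tau>' q)" if "q \<in> {1..n}" for q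
    using that \<tau>'_in[of q] permutes_inverses(2)[OF sorting_perm_permutes, of n f' q]
    by (simp add: refine_labels_def)
  show "labelled_by n (?\<tau>' \<circ> ?\<tau>) (refine_labels n m' f f')"
    unfolding labelled_by_def o_def
  proof
    fix i assume i: "i \<in> {1..<n}"
    define a b where "a = ?\<tau> i" and "b = ?\<tau> (i + 1)"
    have ab: "a \<in> {1..n}" "b \<in> {1..n}"
      using i \<tau>_in[of i] \<tau>_in[of "i + 1"] by (auto simp: a_def b_def)
    have lt: "f' (?\<tau>' a) < m'" "f' (?\<tau>' b) < m'"
      using f' ab \<tau>'_in[of a] \<tau>'_in[of b] by (auto simp: PiE_iff)
    have step: "f a < f b \<or> f a = f b \<and> a < b"
      using labelled_by_sorting_perm[of n f] i by (auto simp: labelled_by_def a_def b_def)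
    have step': "f' (?\<tau>' a) < f' (?\<tau>' b) \<or> f' (?\<tau>' a) = f' (?\<tau>' b) \<and> ?\<tau>' a < ?\<tau>' b" if "a < b"
      using labelled_by_less[OF labelled_by_sorting_perm, of a b n f'] ab that by auto
    show "refine_labels n m' f f' (?\<tau>' (?\<tau> i)) < refine_labels n m' f f' (?\<tau>' (?\<tau> (i + 1))) \<or>
        refine_labels n m' f f' (?\<tau>' (?\<tau> i)) = refine_labels n m' f f' (?\<tau>' (?\<tau> (i + 1))) \<and>
        ?\<tau>' (?\<tau> i) < ?\<tau>' (?\<tau> (i + 1))"
      using step step' ab
      unfolding a_def[symmetric] b_def[symmetric] val[OF ab(1)] val[OF ab(2)]
        two_digit_less_iff[OF lt] by auto
  qed
qed

text \<open>
  The low digit of a label recovers \<open>f'\<close>, hence also the inner sort, and undoing that sort on the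
  high digit recovers \<open>f\<close>. A pair of independent uniform labellings is therefore sent to a uniform
  labelling.
\<close>

lemma bij_betw_refine_labels:
  assumes m': "m' > 0"
  shows "bij_betw (\<lambda>(f, f'). refine_labels n m' f f')
    (labellings n m \<times> labellings n m') (labellings n (m * m'))"
proof -
  have \<tau>_in: "sorting_perm n f p \<in> {1..n} \<longleftrightarrow> p \<in> {1..n}"
    "inv (sorting_perm n f) p \<in> {1..n} \<longleftrightarrow> p \<in> {1..n}" for f p
    by (rule permutes_in_image[OF sorting_perm_permutes],
        rule permutes_in_image[OF permutes_inv[OF sorting_perm_permutes]])
  have inv1: "inv (sorting_perm n f) (sorting_perm n f p) = p"
    "sorting_perm n f (inv (sorting_perm n f) p) = p" for f p
    using permutes_inverses[OF sorting_perm_permutes[of n f]] by auto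
  define low where "low g = restrict (\<lambda>p. g p mod m') {1..n}" for g :: "nat \<Rightarrow> nat"
  define high where "high g = restrict (\<lambda>q. g (sorting_perm n (low g) q) div m') {1..n}"
    for g :: "nat \<Rightarrow> nat"
  have low_refine: "low (refine_labels n m' f f') = f'" if "f' \<in> labellings n m'" for f f'
  proof (rule PiE_ext[OF _ that])
    show "low (refine_labels n m' f f') \<in> labellings n m'" using m' by (auto simp: low_def)
  qed (use that in \<open>auto simp: low_def refine_labels_def PiE_iff\<close>)
  show ?thesis
  proof (rule bij_betw_byWitness[where f' = "\<lambda>g. (high g, low g)"])
    show "\<forall>a\<in>labellings n m \<times> labellings n m'.
        (\<lambda>g. (high g, low g)) ((\<lambda>(f, f'). refine_labels n m' f f') a) = a"
    proof
      fix a assume "a \<in> labellings n m \<times> labellings n m'"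
      then obtain f f' where a: "a = (f, f')"
        and f: "f \<in> labellings n m" and f': "f' \<in> labellings n m'" by blast
      have "high (refine_labels n m' f f') q = f q" for q
      proof (cases "q \<in> {1..n}")
        case True
        then have "f' (sorting_perm n f' q) < m'"
          using f' \<tau>_in(1)[of f' q] by (auto simp: PiE_iff)
        with True show ?thesis
          using \<tau>_in(1)[of f' q]
          by (simp add: high_def low_refine[OF f'] del: One_nat_def)
            (simp add: refine_labels_def inv1)
      next
        case False
        then show ?thesis unfolding high_def PiE_arb[OF f False] by (simp only: restrict_apply if_False)
      qed
      then show "(\<lambda>g. (high g, low g)) ((\<lambda>(f, f'). refine_labels n m' f f') a) = a"
        by (auto simp: a low_refine[OF f'])
    qed
    show "\<forall>g\<in>labellings n (m * m').
        (\<lambda>(f, f'). refine_labels n m' f f') ((\<lambda>g. (high g, low g)) g) = g"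
    proof
      fix g assume g: "g \<in> labellings n (m * m')"
      have "refine_labels n m' (high g) (low g) p = g p" for p
      proof (cases "p \<in> {1..n}")
        case True
        then show ?thesis
          using \<tau>_in(2)[of "low g" p] by (simp add: refine_labels_def high_def inv1) (simp add: low_def)
      next
        case False
        then show ?thesis unfolding refine_labels_def PiE_arb[OF g False]
          by (simp only: restrict_apply if_False)
      qed
      then show "(\<lambda>(f, f'). refine_labels n m' f f') ((\<lambda>g. (high g, low g)) g) = g" by auto
    qed
    show "(\<lambda>(f, f'). refine_labels n m' f f') ` (labellings n m \<times> labellings n m')
        \<subseteq> labellings n (m * m')"
    proof (rule image_subsetI)
      fix a assume "a \<in> labellings n m \<times> labellings n m'"
      then obtain f f' where a: "a = (f, f')"
        and f: "f \<in> labellings n m" and f': "f' \<in> labellings n m'" by blast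
      have "f (inv (sorting_perm n f') p) * m' + f' p < m * m'" if "p \<in> {1..n}" for p
      proof -
        have "f (inv (sorting_perm n f') p) < m"
          using f that \<tau>_in(2)[of f' p] by (auto simp: PiE_iff)
        moreover have "f' p < m'" using f' that by (auto simp: PiE_iff)
        ultimately show ?thesis using two_digit_less_iff[of "f' p" m' 0 _ m] m' by simp
      qed
      then show "(\<lambda>(f, f'). refine_labels n m' f f') a \<in> labellings n (m * m')"
        by (simp add: a refine_labels_def)
    qed
    show "(\<lambda>g. (high g, low g)) ` labellings n (m * m') \<subseteq> labellings n m \<times> labellings n m'"
    proof (rule image_subsetI)
      fix g assume g: "g \<in> labellings n (m * m')"
      have "low g \<in> labellings n m'" using m' by (simp add: low_def)
      have "g (sorting_perm n (low g) q) < m * m'" if "q \<in> {1..n}" for q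
        using g that \<tau>_in(1)[of "low g" q] by (auto simp: PiE_iff)
      then have "high g \<in> labellings n m"
        by (simp add: high_def less_mult_imp_div_less)
      with \<open>low g \<in> labellings n m'\<close>
      show "(high g, low g) \<in> labellings n m \<times> labellings n m'" by blast
    qed
  qed
qed

lemma perm_convolution_riffle_shuffle:
  assumes "m > 0" "m' > 0"
  shows "perm_convolution (riffle_shuffle n m) (riffle_shuffle n m') = riffle_shuffle n (m * m')"
proof -
  let ?A = "labellings n m" and ?B = "labellings n m'"
  let ?s = "\<lambda>f. inv (sorting_perm n f)"
  have ne: "?A \<noteq> {}" "?B \<noteq> {}" using assms by (simp_all add: labellings_nonempty del: One_nat_def)
  have AB: "?A \<times> ?B \<noteq> {}" "finite (?A \<times> ?B)" using ne finite_labellings by blast+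
  have pair: "pair_pmf (pmf_of_set ?A) (pmf_of_set ?B) = pmf_of_set (?A \<times> ?B)"
  proof (rule pmf_eqI)
    fix x :: "(nat \<Rightarrow> nat) \<times> (nat \<Rightarrow> nat)"
    from ne AB show "pmf (pair_pmf (pmf_of_set ?A) (pmf_of_set ?B)) x = pmf (pmf_of_set (?A \<times> ?B)) x"
      using finite_labellings[of n m] finite_labellings[of n m']
      by (cases x) (simp add: pmf_pair card_cartesian_product indicator_def del: One_nat_def)
  qed
  have "perm_convolution (riffle_shuffle n m) (riffle_shuffle n m') =
      map_pmf (\<lambda>(f, f'). ?s f \<circ> ?s f') (pair_pmf (pmf_of_set ?A) (pmf_of_set ?B))"
    using assms
    by (simp add: perm_convolution_def riffle_shuffle_eq_sorting map_pair[symmetric]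
        pmf.map_comp o_def case_prod_unfold)
  also have "\<dots> = map_pmf (\<lambda>(f, f'). ?s f \<circ> ?s f') (pmf_of_set (?A \<times> ?B))"
    by (simp only: pair)
  also have "\<dots> = map_pmf (\<lambda>(f, f'). ?s (refine_labels n m' f f')) (pmf_of_set (?A \<times> ?B))"
  proof (rule map_pmf_cong[OF refl])
    fix x assume "x \<in> set_pmf (pmf_of_set (?A \<times> ?B))"
    then have "x \<in> ?A \<times> ?B" unfolding set_pmf_of_set[OF AB] .
    then obtain f f' where x: "x = (f, f')" "f \<in> ?A" "f' \<in> ?B" by blast
    show "(case x of (f, f') \<Rightarrow> ?s f \<circ> ?s f') =
        (case x of (f, f') \<Rightarrow> ?s (refine_labels n m' f f'))"
      unfolding x(1) prod.case sorting_perm_refine_labels[OF x(2,3)]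
      by (rule o_inv_distrib[symmetric]) (intro permutes_bij[OF sorting_perm_permutes])+
  qed
  also have "\<dots> = map_pmf ?s
      (map_pmf (\<lambda>(f, f'). refine_labels n m' f f') (pmf_of_set (?A \<times> ?B)))"
    by (simp add: pmf.map_comp o_def case_prod_unfold)
  also have "map_pmf (\<lambda>(f, f'). refine_labels n m' f f') (pmf_of_set (?A \<times> ?B)) =
      pmf_of_set (labellings n (m * m'))"
    by (rule map_pmf_of_set_bij_betw[OF bij_betw_refine_labels[OF assms(2)] AB])
  also have "map_pmf ?s (pmf_of_set (labellings n (m * m'))) = riffle_shuffle n (m * m')"
    using assms by (simp add: riffle_shuffle_eq_sorting)
  finally show ?thesis .
qed

lemma riffle_shuffle_one: "riffle_shuffle n 1 = return_pmf id"
proof -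
  have "sorting_perm n f = id" if "f \<in> labellings n 1" for f
    by (rule sorting_perm_eqI) (use that in \<open>auto simp: permutes_id labelled_by_def PiE_iff\<close>)
  then have "map_pmf (\<lambda>f. inv (sorting_perm n f)) (pmf_of_set (labellings n 1)) =
      map_pmf (\<lambda>_. id) (pmf_of_set (labellings n 1))"
    by (intro map_pmf_cong refl)
      (simp add: labellings_nonempty finite_labellings del: One_nat_def)
  then show ?thesis by (simp add: riffle_shuffle_eq_sorting map_pmf_const)
qed

text \<open>
  This reduces the study of the whole random walk to the single explicit family of Bayer-Diaconis
  weights, with the number of packs as the only parameter.
\<close>

lemma convolution_power_riffle_shuffle:
  assumes "m > 0"
  shows "convolution_power (riffle_shuffle n m) k = riffle_shuffle n (m ^ k)"
proof (induction k)
  case 0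
  show ?case using riffle_shuffle_one by (simp add: convolution_power_def)
next
  case (Suc k)
  then show ?case using assms by (simp add: convolution_power_def perm_convolution_riffle_shuffle)
qed

section \<open>Concentration of the number of rising sequences\<close>

definition step_sign :: "(nat \<Rightarrow> nat) \<Rightarrow> nat \<Rightarrow> real"
  where "step_sign \<tau> i = (if \<tau> (i + 1) < \<tau> i then -1 else 1)"

text \<open>
  The deficit of the number of rising sequences below its mean \<open>(n + 1) / 2\<close> under the uniform
  distribution. The sign is chosen so that a riffle shuffle, which favours arrangements with few
  rising sequences, favours large values.
\<close>

definition rising_deficit :: "nat \<Rightarrow> (nat \<Rightarrow> nat) \<Rightarrow> real"
  where "rising_deficit n \<sigma> = (real n + 1) / 2 - real (rising_sequences n \<sigma>)"

lemma rising_deficit_eq_signs: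
  assumes "n \<ge> 1"
  shows "rising_deficit n \<sigma> = (\<Sum>i\<in>{1..<n}. step_sign (inv \<sigma>) i) / 2"
proof -
  let ?D = "{i \<in> {1..<n}. inv \<sigma> (i + 1) < inv \<sigma> i}"
  have "step_sign (inv \<sigma>) i = 1 - 2 * of_bool (inv \<sigma> (i + 1) < inv \<sigma> i)" for i
    by (simp add: step_sign_def)
  then have "(\<Sum>i\<in>{1..<n}. step_sign (inv \<sigma>) i) = real (n - 1) - 2 * real (card ?D)"
    by (simp add: sum_subtractf flip: sum_distrib_left) (simp add: of_bool_def sum.If_cases Int_def)
  with assms show ?thesis
    by (simp add: rising_deficit_def rising_sequences_def of_nat_diff field_simps)
qed

text \<open>
  Exchanging the values at positions \<open>i\<close> and \<open>i + 1\<close> flips the comparison between these two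
  positions and leaves untouched every comparison that involves neither of them.
\<close>

lemma sum_step_sign_product_zero:
  assumes i: "i \<in> {1..<n}" and j: "j + 1 < i \<or> i + 1 < j"
  shows "(\<Sum>\<tau> | \<tau> permutes {1..n}. step_sign \<tau> i * step_sign \<tau> j) = 0"
proof -
  let ?q = "Transposition.transpose i (i + 1)"
  have q: "?q permutes {1..n}" using i by (intro permutes_swap_id) auto
  have "(\<Sum>\<tau> | \<tau> permutes {1..n}. step_sign \<tau> i * step_sign \<tau> j) =
      (\<Sum>\<tau> | \<tau> permutes {1..n}. step_sign (\<tau> \<circ> ?q) i * step_sign (\<tau> \<circ> ?q) j)"
    by (rule sum_permutations_compose_right[OF q])
  also have "\<dots> = (\<Sum>\<tau> | \<tau> permutes {1..n}. - (step_sign \<tau> i * step_sign \<tau> j))"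
  proof (intro sum.cong refl)
    fix \<tau> :: "nat \<Rightarrow> nat" assume "\<tau> \<in> {\<tau>. \<tau> permutes {1..n}}"
    then have "\<tau> (i + 1) \<noteq> \<tau> i" using permutes_inj by (metis injD mem_Collect_eq n_not_Suc_n Suc_eq_plus1)
    then have "step_sign (\<tau> \<circ> ?q) i = - step_sign \<tau> i" by (auto simp: step_sign_def)
    moreover have "step_sign (\<tau> \<circ> ?q) j = step_sign \<tau> j"
      using j by (auto simp: step_sign_def transpose_def)
    ultimately show "step_sign (\<tau> \<circ> ?q) i * step_sign (\<tau> \<circ> ?q) j = - (step_sign \<tau> i * step_sign \<tau> j)"
      by simp
  qed
  finally show ?thesis by (simp add: sum_negf)
qed

text \<open>
  Only pairs of equal or adjacent indices survive in the expanded square, fewer than \<open>3 * n\<close> of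
  them, so the second moment grows linearly in \<open>n\<close>, as does the exact variance \<open>(n + 1) / 12\<close>.
\<close>

lemma sum_rising_deficit_squared:
  assumes n: "n \<ge> 1"
  shows "(\<Sum>\<sigma> | \<sigma> permutes {1..n}. (rising_deficit n \<sigma>)\<^sup>2) \<le> real n * fact n"
proof -
  let ?S = "{\<sigma>. \<sigma> permutes {1..n}}" and ?I = "{1..<n}"
  have cardS: "card ?S = fact n" by (simp add: card_permutations)
  have near: "(\<Sum>\<tau>\<in>?S. step_sign \<tau> i * step_sign \<tau> j) \<le> (if j \<in> {i - 1..i + 1} then fact n else 0)"
    if i: "i \<in> ?I" for i j
  proof (cases "j \<in> {i - 1..i + 1}")
    case True
    have "(\<Sum>\<tau>\<in>?S. step_sign \<tau> i * step_sign \<tau> j) \<le> (\<Sum>\<tau>\<in>?S. 1)"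
      by (intro sum_mono) (simp add: step_sign_def)
    also have "\<dots> = fact n" unfolding sum_constant cardS by simp
    finally show ?thesis using True by simp
  next
    case False
    then have "j + 1 < i \<or> i + 1 < j" by auto
    from sum_step_sign_product_zero[OF i this] False show ?thesis by simp
  qed
  have row: "(\<Sum>j\<in>?I. if j \<in> {i - 1..i + 1} then fact n else 0) \<le> 3 * (fact n :: real)" for i
  proof -
    have "card (?I \<inter> {i - 1..i + 1}) \<le> card {i - 1..i + 1}" by (intro card_mono) auto
    then have "card (?I \<inter> {i - 1..i + 1}) \<le> 3" by simp
    moreover have "(\<Sum>j\<in>?I. if j \<in> {i - 1..i + 1} then fact n else 0) =
        (\<Sum>j\<in>?I \<inter> {i - 1..i + 1}. fact n :: real)"
      by (rule sum.inter_restrict[symmetric]) simp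
    ultimately show ?thesis by simp
  qed
  have "(\<Sum>\<sigma>\<in>?S. (rising_deficit n \<sigma>)\<^sup>2) = (\<Sum>\<sigma>\<in>?S. (\<Sum>i\<in>?I. step_sign (inv \<sigma>) i)\<^sup>2 / 4)"
    by (simp add: rising_deficit_eq_signs[OF n] power_divide)
  also have "\<dots> = (\<Sum>\<tau>\<in>?S. (\<Sum>i\<in>?I. step_sign \<tau> i)\<^sup>2 / 4)"
    by (rule sum_permutations_inverse[symmetric])
  also have "\<dots> = (\<Sum>\<tau>\<in>?S. \<Sum>i\<in>?I. \<Sum>j\<in>?I. step_sign \<tau> i * step_sign \<tau> j) / 4"
    by (simp add: power2_eq_square sum_product sum_divide_distrib)
  also have "(\<Sum>\<tau>\<in>?S. \<Sum>i\<in>?I. \<Sum>j\<in>?I. step_sign \<tau> i * step_sign \<tau> j) =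
      (\<Sum>i\<in>?I. \<Sum>j\<in>?I. \<Sum>\<tau>\<in>?S. step_sign \<tau> i * step_sign \<tau> j)"
    by (subst sum.swap) (intro sum.cong refl, rule sum.swap)
  also have "\<dots> \<le> (\<Sum>i\<in>?I. \<Sum>j\<in>?I. if j \<in> {i - 1..i + 1} then fact n else 0)"
    by (intro sum_mono near)
  also have "\<dots> \<le> (\<Sum>i\<in>?I. 3 * fact n)"
    by (intro sum_mono row)
  also have "\<dots> / 4 \<le> real n * fact n" using n by (simp add: of_nat_diff field_simps)
  finally show ?thesis by simp
qed

lemma uniform_perm_chebyshev:
  assumes n: "n \<ge> 1" and K: "K > 0"
  shows "measure_pmf.prob (uniform_perm n) {\<sigma>. \<bar>rising_deficit n \<sigma>\<bar> > K * sqrt n} \<le> 1 / K\<^sup>2"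
proof -
  let ?S = "{\<sigma>. \<sigma> permutes {1..n}}" and ?B = "{\<sigma>. \<bar>rising_deficit n \<sigma>\<bar> > K * sqrt n}"
  have fin: "finite ?S" by (rule finite_permutations) simp
  have ne: "?S \<noteq> {}" using permutes_id by blast
  have cardS: "card ?S = fact n" by (simp add: card_permutations)
  have "real (card (?S \<inter> ?B)) * (K\<^sup>2 * n) = (\<Sum>\<sigma>\<in>?S \<inter> ?B. (K * sqrt n)\<^sup>2)"
    by (simp add: power_mult_distrib)
  also have "\<dots> \<le> (\<Sum>\<sigma>\<in>?S \<inter> ?B. (rising_deficit n \<sigma>)\<^sup>2)"
    using K by (intro sum_mono) (simp add: abs_le_square_iff[symmetric])
  also have "\<dots> \<le> (\<Sum>\<sigma>\<in>?S. (rising_deficit n \<sigma>)\<^sup>2)"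
    using fin by (intro sum_mono2) auto
  also have "\<dots> \<le> real n * fact n" by (rule sum_rising_deficit_squared[OF n])
  finally have "real (card (?S \<inter> ?B)) * K\<^sup>2 \<le> fact n"
    using n by (simp add: mult.assoc[symmetric])
  then have "real (card (?S \<inter> ?B)) / fact n \<le> 1 / K\<^sup>2"
    using K by (simp add: field_simps)
  then show ?thesis
    using fin ne cardS by (simp add: uniform_perm_def measure_pmf_of_set)
qed

section \<open>The density of a riffle shuffle\<close>

text \<open>
  The density of the shuffle with respect to the uniform distribution, at an arrangement with at
  most \<open>m\<close> rising sequences: the product of the factors \<open>m + j - r\<close> in the numerator of the binomial
  coefficient, each divided by \<open>m\<close>.
\<close>

definition density_ratio :: "nat \<Rightarrow> nat \<Rightarrow> (nat \<Rightarrow> nat) \<Rightarrow> real"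
  where "density_ratio n m \<sigma> =
    (\<Prod>j=1..n. 1 + (real j - real (rising_sequences n \<sigma>)) / real m)"

lemma rising_sequences_bounds:
  "1 \<le> rising_sequences n \<sigma>" "n \<ge> 1 \<Longrightarrow> rising_sequences n \<sigma> \<le> n"
proof -
  have "card {i \<in> {1..<n}. inv \<sigma> (i + 1) < inv \<sigma> i} \<le> card {1..<n}"
    by (intro card_mono) auto
  then show "1 \<le> rising_sequences n \<sigma>" "n \<ge> 1 \<Longrightarrow> rising_sequences n \<sigma> \<le> n"
    by (auto simp: rising_sequences_def)
qed

lemma pmf_riffle_shuffle_density:
  assumes n: "n \<ge> 1" and m: "m > 0" and r: "rising_sequences n \<sigma> \<le> m"
    and \<sigma>: "\<sigma> permutes {1..n}"
  shows "pmf (riffle_shuffle n m) \<sigma> = density_ratio n m \<sigma> / fact n"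
proof -
  let ?r = "rising_sequences n \<sigma>"
  let ?g = "\<lambda>j. real m + real j - real ?r"
  have "real ((n + m - ?r) choose n) = (\<Prod>i=0..<n. real (n + m - ?r) - real i) / fact n"
    by (simp add: binomial_gbinomial gbinomial_prod_rev)
  also have "(\<Prod>i=0..<n. real (n + m - ?r) - real i) = (\<Prod>j\<in>{1..n}. ?g j)"
    by (rule prod.reindex_bij_witness[of _ "\<lambda>j. n - j" "\<lambda>i. n - i"])
      (use r in \<open>auto simp: of_nat_diff\<close>)
  also have "\<dots> = real m ^ n * density_ratio n m \<sigma>"
  proof -
    have "(\<Prod>j\<in>{1..n}. ?g j) = (\<Prod>j\<in>{1..n}. real m * (1 + (real j - real ?r) / real m))"
      using m by (intro prod.cong refl) (simp add: field_simps)
    then show ?thesis by (simp add: prod.distrib density_ratio_def)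
  qed
  finally show ?thesis
    using m \<sigma> by (simp add: pmf_riffle_shuffle[OF m] shuffle_weight_def)
qed

lemma pmf_riffle_shuffle_zero:
  assumes n: "n \<ge> 1" and m: "m > 0" and r: "rising_sequences n \<sigma> > m"
  shows "pmf (riffle_shuffle n m) \<sigma> = 0"
  using assms by (simp add: pmf_riffle_shuffle[OF m] shuffle_weight_def binomial_eq_0_iff) linarith

text \<open>
  An upper bound for \<open>1 + x\<close> that keeps a quadratic gain over \<open>exp x\<close> and holds even when \<open>x\<close> is large,
  since the shuffle may have far fewer packs than cards. The gain must shrink with the bound \<open>b\<close> on
  \<open>x\<close>, because \<open>x - x\<^sup>2 / 2\<close> is negative for large \<open>x\<close> while \<open>ln (1 + x)\<close> is not.
\<close>

lemma one_plus_le_exp_quadratic: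
  fixes x b :: real
  assumes "-1 \<le> x" "x \<le> b" "0 \<le> b"
  shows "1 + x \<le> exp (x - x\<^sup>2 / (2 * (1 + b)))"
proof (cases "x = -1")
  case False
  then have x: "x > -1" using assms by simp
  have "ln (1 + x) \<le> x - x\<^sup>2 / (2 * (1 + b))"
  proof (cases "x \<ge> 0")
    case True
    define g where "g = (\<lambda>u::real. u - u\<^sup>2 / (2 * (1 + b)) - ln (1 + u))"
    have "g 0 \<le> g x"
    proof (rule DERIV_nonneg_imp_nondecreasing[OF True])
      fix u assume u: "0 \<le> u" "u \<le> x"
      have "(g has_real_derivative 1 - 2 * u / (2 * (1 + b)) - 1 / (1 + u)) (at u)"
        unfolding g_def using u assms by (auto intro!: derivative_eq_intros)
      moreover have "1 - 2 * u / (2 * (1 + b)) - 1 / (1 + u) = u * (b - u) / ((1 + b) * (1 + u))"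
      proof -
        have "1 - u / q - 1 / r = (q * r - u * r - q) / (q * r)" if "q \<noteq> 0" "r \<noteq> 0"
          for q r :: real using that by (simp add: field_simps)
        from this[of "1 + b" "1 + u"] have "1 - u / (1 + b) - 1 / (1 + u) =
            ((1 + b) * (1 + u) - u * (1 + u) - (1 + b)) / ((1 + b) * (1 + u))"
          using u assms by auto
        also have "(1 + b) * (1 + u) - u * (1 + u) - (1 + b) = u * (b - u)"
          by (simp add: algebra_simps)
        also have "u / (1 + b) = 2 * u / (2 * (1 + b))"
          by (rule mult_divide_mult_cancel_left[symmetric]) simp
        finally show ?thesis .
      qed
      moreover have "\<dots> \<ge> 0" using u assms by simp
      ultimately show "\<exists>y. (g has_real_derivative y) (at u) \<and> 0 \<le> y" by metis
    qed
    then show ?thesis by (simp add: g_def)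
  next
    case False
    define g where "g = (\<lambda>u::real. u - u\<^sup>2 / 2 - ln (1 + u))"
    have "g x \<ge> g 0"
    proof (rule DERIV_nonpos_imp_nonincreasing[where f = g and a = x and b = 0])
      fix u assume u: "x \<le> u" "u \<le> 0"
      have "(g has_real_derivative 1 - u - 1 / (1 + u)) (at u)"
        unfolding g_def using u x by (auto intro!: derivative_eq_intros)
      moreover have "1 - u - 1 / (1 + u) = - (u\<^sup>2 / (1 + u))"
        using u x by (simp add: field_simps power2_eq_square)
      moreover have "\<dots> \<le> 0" using u x by simp
      ultimately show "\<exists>y. (g has_real_derivative y) (at u) \<and> y \<le> 0" by metis
    qed (use False in simp)
    then have "ln (1 + x) \<le> x - x\<^sup>2 / 2" by (simp add: g_def)
    also have "\<dots> \<le> x - x\<^sup>2 / (2 * (1 + b))"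
      using assms by (intro diff_left_mono divide_left_mono) auto
    finally show ?thesis .
  qed
  then have "exp (ln (1 + x)) \<le> exp (x - x\<^sup>2 / (2 * (1 + b)))" by simp
  then show ?thesis using x by simp
qed simp

lemma sum_factor_deviations:
  "(\<Sum>j=1..n. real j - real (rising_sequences n \<sigma>)) = real n * rising_deficit n \<sigma>"
proof -
  have "(\<Sum>j=1..n. real j) = real n * (real n + 1) / 2"
    by (induction n) (simp_all add: field_simps)
  then show ?thesis by (simp add: sum_subtractf rising_deficit_def algebra_simps)
qed

text \<open>
  The sum is smallest when \<open>r\<close> is the mean \<open>(n + 1) / 2\<close>; the bound is its value there.
\<close>

lemma sum_squares_about_point_ge:
  fixes r :: real
  shows "(\<Sum>j=1..n. (real j - r)\<^sup>2) \<ge> real n * ((real n)\<^sup>2 - 1) / 12"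
proof -
  have "(\<Sum>j=1..n. (real j - r)\<^sup>2) =
      real n * ((real n)\<^sup>2 - 1) / 12 + real n * ((real n + 1) / 2 - r)\<^sup>2"
  proof -
    have 1: "(\<Sum>j=1..n. real j) = real n * (real n + 1) / 2"
      by (induction n) (simp_all add: field_simps)
    have 2: "(\<Sum>j=1..n. (real j)\<^sup>2) = real n * (real n + 1) * (2 * real n + 1) / 6"
      by (induction n) (simp_all add: field_simps power2_eq_square)
    have "(\<Sum>j=1..n. (real j - r)\<^sup>2) = (\<Sum>j=1..n. (real j)\<^sup>2 - 2 * r * real j + r\<^sup>2)"
      by (simp add: power2_eq_square algebra_simps)
    also have "\<dots> = (\<Sum>j=1..n. (real j)\<^sup>2) - 2 * r * (\<Sum>j=1..n. real j) + real n * r\<^sup>2"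
      by (simp add: sum.distrib sum_subtractf sum_distrib_left)
    finally show ?thesis unfolding 1 2 by (simp add: field_simps power2_eq_square)
  qed
  then show ?thesis by simp
qed

text \<open>
  With many packs every factor \<open>1 + x\<close> has \<open>\<bar>x\<bar> \<le> 1 / 2\<close>, so the logarithm of the density is the sum of
  the \<open>x\<close> up to twice the sum of their squares. The former is \<open>n / m\<close> times the rising deficit, the
  latter is at most \<open>2 n\<^sup>3 / m\<^sup>2\<close>. For a deficit of order \<open>sqrt n\<close> both are controlled by the ratio of \<open>n * sqrt n\<close> to \<open>m\<close>, which is
  how the exponent \<open>3 / 2\<close> enters.
\<close>

lemma density_ratio_ge:
  assumes n: "n \<ge> 1" and m: "2 * n \<le> m" and K: "rising_deficit n \<sigma> \<ge> - (K * sqrt n)"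
  shows "density_ratio n m \<sigma> \<ge>
    exp (- K * (real n * sqrt n / real m) - 2 * (real n * sqrt n / real m)\<^sup>2)"
proof -
  let ?r = "real (rising_sequences n \<sigma>)"
  define x where "x j = (real j - ?r) / real m" for j
  have m0: "real m > 0" using n m by simp
  have x: "\<bar>x j\<bar> \<le> real n / real m" if "j \<in> {1..n}" for j
    using that rising_sequences_bounds[where n = n and \<sigma> = \<sigma>] n m0
    by (auto simp: x_def abs_if divide_simps)
  have sum_x: "(\<Sum>j=1..n. x j) = real n * rising_deficit n \<sigma> / real m"
    by (simp only: x_def sum_divide_distrib[symmetric] sum_factor_deviations)
  have half: "real n / real m \<le> 1 / 2" using m m0 by (simp add: field_simps)
  have "- K * (real n * sqrt n / real m) - 2 * (real n * sqrt n / real m)\<^sup>2 =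
      real n * (- (K * sqrt n)) / real m - (\<Sum>j=1..n. 2 * (real n / real m)\<^sup>2)"
  proof -
    have "(real n * sqrt n / real m)\<^sup>2 = real n * (real n / real m)\<^sup>2"
      by (simp add: power_mult_distrib power_divide)
    then show ?thesis by simp
  qed
  also have "\<dots> \<le> real n * rising_deficit n \<sigma> / real m - (\<Sum>j=1..n. 2 * (x j)\<^sup>2)"
  proof (intro diff_mono divide_right_mono mult_left_mono sum_mono)
    fix j assume "j \<in> {1..n}"
    from power_mono[OF x[OF this] abs_ge_zero, of 2] show "(x j)\<^sup>2 \<le> (real n / real m)\<^sup>2"
      by simp
  qed (use K in auto)
  also have "\<dots> = (\<Sum>j=1..n. x j - 2 * (x j)\<^sup>2)"
    by (simp only: sum_subtractf sum_x)
  finally have "exp (- K * (real n * sqrt n / real m) - 2 * (real n * sqrt n / real m)\<^sup>2)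
      \<le> exp (\<Sum>j=1..n. x j - 2 * (x j)\<^sup>2)" by simp
  also have "\<dots> = (\<Prod>j=1..n. exp (x j - 2 * (x j)\<^sup>2))" by (simp add: exp_sum)
  also have "\<dots> \<le> (\<Prod>j=1..n. 1 + x j)"
  proof (intro prod_mono conjI)
    fix j assume "j \<in> {1..n}"
    with x half have le: "\<bar>x j\<bar> \<le> 1 / 2" by (meson order_trans)
    have "x j - 2 * (x j)\<^sup>2 \<le> ln (1 + x j)"
      using abs_ln_one_plus_x_minus_x_bound[OF le] by linarith
    then have "exp (x j - 2 * (x j)\<^sup>2) \<le> exp (ln (1 + x j))" by simp
    also have "\<dots> = 1 + x j" using le by (subst exp_ln) auto
    finally show "exp (x j - 2 * (x j)\<^sup>2) \<le> 1 + x j" .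
  qed simp
  finally show ?thesis by (simp add: density_ratio_def x_def)
qed

text \<open>
  In the opposite regime the quadratic term wins. Its size is bounded below whatever the number of
  rising sequences is, so for a typical rising deficit, of order \<open>sqrt n\<close>, the linear term cannot
  compensate it once \<open>m\<close> is small compared with \<open>n * sqrt n\<close>.
\<close>

lemma density_ratio_le:
  assumes n: "n \<ge> 2" and m: "m > 0" and r: "rising_sequences n \<sigma> \<le> m"
    and K: "rising_deficit n \<sigma> \<le> K * sqrt n"
  shows "density_ratio n m \<sigma> \<le>
    exp (K * (real n * sqrt n / real m) - (real n * sqrt n)\<^sup>2 / (32 * real m * (real m + real n)))"
proof -
  let ?r = "real (rising_sequences n \<sigma>)"
  define x where "x j = (real j - ?r) / real m" for j
  define b where "b = real n / real m"
  have m0: "real m > 0" using m by simp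
  have b: "b \<ge> 0" by (simp add: b_def)
  have x: "-1 \<le> x j" "x j \<le> b" if "j \<in> {1..n}" for j
    using that rising_sequences_bounds(1)[of n \<sigma>] r m0
    by (auto simp: x_def b_def divide_simps)
  have sum_x: "(\<Sum>j=1..n. x j) = real n * rising_deficit n \<sigma> / real m"
    by (simp only: x_def sum_divide_distrib[symmetric] sum_factor_deviations)
  have "density_ratio n m \<sigma> = (\<Prod>j=1..n. 1 + x j)" by (simp add: density_ratio_def x_def)
  also have "\<dots> \<le> (\<Prod>j=1..n. exp (x j - (x j)\<^sup>2 / (2 * (1 + b))))"
  proof (intro prod_mono conjI)
    fix j assume j: "j \<in> {1..n}"
    show "0 \<le> 1 + x j" using x(1)[OF j] by simp
    show "1 + x j \<le> exp (x j - (x j)\<^sup>2 / (2 * (1 + b)))"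
      by (rule one_plus_le_exp_quadratic[OF x(1)[OF j] x(2)[OF j] b])
  qed
  also have "\<dots> = exp (\<Sum>j=1..n. x j - (x j)\<^sup>2 / (2 * (1 + b)))" by (simp add: exp_sum)
  also have "(\<Sum>j=1..n. x j - (x j)\<^sup>2 / (2 * (1 + b))) =
      real n * rising_deficit n \<sigma> / real m -
      (\<Sum>j=1..n. (real j - ?r)\<^sup>2) / (real m)\<^sup>2 / (2 * (1 + b))"
    by (simp only: sum_subtractf sum_x) (simp only: x_def power_divide sum_divide_distrib)
  also have "\<dots> \<le> real n * (K * sqrt n) / real m - (real n ^ 3 / 16) / (real m)\<^sup>2 / (2 * (1 + b))"
  proof -
    (* n^2 - 1 is at least 3/4 of n^2, which trades the constant 12 for 16. *)
    have "(2::real)\<^sup>2 \<le> (real n)\<^sup>2" using n by (intro power_mono) auto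
    then have "real n * (real n)\<^sup>2 / 16 \<le> real n * ((real n)\<^sup>2 - 1) / 12"
      using mult_left_mono[of 4 "(real n)\<^sup>2" "real n"] by (simp add: algebra_simps)
    also have "\<dots> \<le> (\<Sum>j=1..n. (real j - ?r)\<^sup>2)" by (rule sum_squares_about_point_ge)
    finally have "real n ^ 3 / 16 \<le> (\<Sum>j=1..n. (real j - ?r)\<^sup>2)"
      by (simp add: power2_eq_square power3_eq_cube)
    then show ?thesis using K m0 b
      by (intro diff_mono divide_right_mono mult_left_mono) auto
  qed
  also have "\<dots> = K * (real n * sqrt n / real m) -
      (real n * sqrt n)\<^sup>2 / (32 * real m * (real m + real n))"
    using m0 by (simp add: b_def power_mult_distrib power2_eq_square power3_eq_cube divide_simps)
  finally show ?thesis by simp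
qed

section \<open>Total variation bounds from density bounds\<close>

lemma prob_diff_le_tv_dist:
  "measure_pmf.prob P A - measure_pmf.prob Q A \<le> tv_dist P Q"
  unfolding tv_dist_def
proof (rule cSUP_upper[OF UNIV_I bdd_aboveI2])
  fix A show "measure_pmf.prob P A - measure_pmf.prob Q A \<le> 1"
    using measure_pmf.prob_le_1[of P A] measure_nonneg[of Q A] by linarith
qed

lemma tv_dist_leI:
  assumes "\<And>A. measure_pmf.prob P A - measure_pmf.prob Q A \<le> d"
  shows "tv_dist P Q \<le> d"
  unfolding tv_dist_def by (rule cSUP_least) (use assms in auto)

lemma tv_dist_nonneg: "0 \<le> tv_dist P Q"
  using prob_diff_le_tv_dist[of P "{}" Q] by simp

lemma tv_dist_le_1: "tv_dist P Q \<le> 1"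
proof (rule tv_dist_leI)
  fix A show "measure_pmf.prob P A - measure_pmf.prob Q A \<le> 1"
    using measure_pmf.prob_le_1[of P A] measure_nonneg[of Q A] by linarith
qed

lemma prob_Compl_pmf: "measure_pmf.prob P (- A) = 1 - measure_pmf.prob P A"
  using measure_pmf.prob_compl[of A P] by (simp add: Compl_eq_Diff_UNIV)

lemma prob_le_of_pmf_le:
  fixes P Q :: "'a pmf" and a b :: real
  assumes fin: "finite (set_pmf P)" and b: "b \<ge> 0"
    and le: "\<And>x. x \<in> A \<Longrightarrow> x \<in> set_pmf P \<Longrightarrow> a * pmf P x \<le> b * pmf Q x"
  shows "a * measure_pmf.prob P A \<le> b * measure_pmf.prob Q A"
proof -
  let ?A = "A \<inter> set_pmf P"
  have "a * measure_pmf.prob P A = a * measure_pmf.prob P ?A"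
    by (simp only: measure_Int_set_pmf)
  also have "\<dots> = (\<Sum>x\<in>?A. a * pmf P x)"
    using fin by (simp add: measure_measure_pmf_finite sum_distrib_left del: measure_Int_set_pmf)
  also have "\<dots> \<le> (\<Sum>x\<in>?A. b * pmf Q x)" using le by (intro sum_mono) auto
  also have "\<dots> = b * measure_pmf.prob Q ?A"
    using fin by (simp add: measure_measure_pmf_finite sum_distrib_left)
  also have "\<dots> \<le> b * measure_pmf.prob Q A"
    using b by (intro mult_left_mono measure_pmf.finite_measure_mono) auto
  finally show ?thesis .
qed

text \<open>
  The distance to \<open>U\<close> only sees where \<open>P\<close> falls below \<open>U\<close>: a lower bound on the density outside a set
  of small \<open>U\<close>-probability already controls it.
\<close>

lemma tv_dist_le_of_pmf_ge:
  assumes fin: "finite (set_pmf U)" and \<rho>: "0 \<le> \<rho>" "\<rho> \<le> 1"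
    and le: "\<And>x. x \<in> G \<Longrightarrow> x \<in> set_pmf U \<Longrightarrow> \<rho> * pmf U x \<le> pmf P x"
    and bad: "measure_pmf.prob U (- G) \<le> \<epsilon>"
  shows "tv_dist P U \<le> \<epsilon> + 1 - \<rho>"
proof (rule tv_dist_leI)
  fix A
  let ?B = "- A \<inter> G"
  (* Passing to complements turns an excess of P into a deficit of P. *)
  have "measure_pmf.prob P A - measure_pmf.prob U A =
      measure_pmf.prob U (- A) - measure_pmf.prob P (- A)"
    by (simp add: prob_Compl_pmf)
  also have "\<dots> \<le> (\<epsilon> + measure_pmf.prob U ?B) - \<rho> * measure_pmf.prob U ?B"
  proof (rule diff_mono)
    have "measure_pmf.prob U (- A) \<le> measure_pmf.prob U (- G \<union> ?B)"
      by (rule measure_pmf.finite_measure_mono) auto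
    also have "\<dots> \<le> measure_pmf.prob U (- G) + measure_pmf.prob U ?B"
      by (rule measure_Un_le) auto
    finally show "measure_pmf.prob U (- A) \<le> \<epsilon> + measure_pmf.prob U ?B" using bad by simp
    have "\<rho> * measure_pmf.prob U ?B \<le> 1 * measure_pmf.prob P ?B"
      by (rule prob_le_of_pmf_le[OF fin]) (use le in auto)
    also have "\<dots> \<le> measure_pmf.prob P (- A)"
      using measure_pmf.finite_measure_mono[of ?B "- A" P] by simp
    finally show "\<rho> * measure_pmf.prob U ?B \<le> measure_pmf.prob P (- A)" .
  qed
  also have "\<dots> = \<epsilon> + (1 - \<rho>) * measure_pmf.prob U ?B" by (simp add: algebra_simps)
  also have "\<dots> \<le> \<epsilon> + (1 - \<rho>)" using \<rho> by (simp add: mult_left_le)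
  finally show "measure_pmf.prob P A - measure_pmf.prob U A \<le> \<epsilon> + 1 - \<rho>" by simp
qed

text \<open>
  If \<open>P\<close> has small density on a set that carries almost all of \<open>U\<close>, that set separates the two.
\<close>

lemma tv_dist_ge_of_pmf_le:
  assumes fin: "finite (set_pmf P)" and \<rho>: "0 \<le> \<rho>"
    and le: "\<And>x. x \<in> G \<Longrightarrow> x \<in> set_pmf P \<Longrightarrow> pmf P x \<le> \<rho> * pmf U x"
    and bad: "measure_pmf.prob U (- G) \<le> \<epsilon>"
  shows "1 - \<epsilon> - \<rho> \<le> tv_dist P U"
proof -
  have "measure_pmf.prob P G \<le> \<rho> * measure_pmf.prob U G"
    using prob_le_of_pmf_le[OF fin \<rho>, of G 1 U] le by simp
  also have "\<dots> \<le> \<rho>" using \<rho> by (simp add: mult_left_le)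
  finally have "1 - \<epsilon> - \<rho> \<le> measure_pmf.prob P (- G) - measure_pmf.prob U (- G)"
    using bad by (simp add: prob_Compl_pmf)
  also have "\<dots> \<le> tv_dist P U" by (rule prob_diff_le_tv_dist)
  finally show ?thesis .
qed

lemma pmf_uniform_perm:
  "pmf (uniform_perm n) \<sigma> = (if \<sigma> permutes {1..n} then 1 / fact n else 0)"
  and set_pmf_uniform_perm: "set_pmf (uniform_perm n) = {\<sigma>. \<sigma> permutes {1..n}}"
proof -
  let ?S = "{\<sigma>. \<sigma> permutes {1..n}}"
  have S: "finite ?S" "?S \<noteq> {}" "card ?S = fact n"
    using finite_permutations[of "{1..n}"] card_permutations[of "{1..n}" n]
    by (auto intro: permutes_id)
  show "pmf (uniform_perm n) \<sigma> = (if \<sigma> permutes {1..n} then 1 / fact n else 0)"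
    unfolding uniform_perm_def pmf_of_set[OF S(2,1)] S(3) by (simp add: indicator_def)
  show "set_pmf (uniform_perm n) = ?S"
    unfolding uniform_perm_def by (rule set_pmf_of_set[OF S(2,1)])
qed

lemma set_pmf_riffle_shuffle:
  assumes "m > 0"
  shows "set_pmf (riffle_shuffle n m) \<subseteq> {\<sigma>. \<sigma> permutes {1..n}}"
  by (auto simp: set_pmf_iff pmf_riffle_shuffle[OF assms] shuffle_weight_def split: if_splits)

lemma tv_dist_riffle_shuffle_le:
  assumes n: "n \<ge> 1" and m: "2 * n \<le> m" and K: "K > 0"
  shows "tv_dist (riffle_shuffle n m) (uniform_perm n) \<le> 1 / K\<^sup>2 + 1 -
    exp (- K * (real n * sqrt n / real m) - 2 * (real n * sqrt n / real m)\<^sup>2)"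
    (is "_ \<le> _ + 1 - ?\<rho>")
proof (rule tv_dist_le_of_pmf_ge)
  let ?G = "{\<sigma>. \<bar>rising_deficit n \<sigma>\<bar> \<le> K * sqrt n}"
  show "finite (set_pmf (uniform_perm n))"
    by (simp add: set_pmf_uniform_perm finite_permutations)
  show "0 \<le> ?\<rho>" by simp
  have "0 \<le> K * (real n * sqrt n / real m)" using K by simp
  moreover have "0 \<le> (real n * sqrt n / real m)\<^sup>2" by simp
  ultimately have "- K * (real n * sqrt n / real m) - 2 * (real n * sqrt n / real m)\<^sup>2 \<le> 0"
    unfolding mult_minus_left by linarith
  then show "?\<rho> \<le> 1" by simp
  have "- ?G = {\<sigma>. \<bar>rising_deficit n \<sigma>\<bar> > K * sqrt n}" by auto
  with uniform_perm_chebyshev[OF n K]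
  show "measure_pmf.prob (uniform_perm n) (- ?G) \<le> 1 / K\<^sup>2" by simp
  fix \<sigma> assume G: "\<sigma> \<in> ?G" and "\<sigma> \<in> set_pmf (uniform_perm n)"
  then have \<sigma>: "\<sigma> permutes {1..n}" by (simp add: set_pmf_uniform_perm)
  have "rising_sequences n \<sigma> \<le> m" "m > 0"
    using rising_sequences_bounds(2)[OF n, of \<sigma>] n m by linarith+
  then have "pmf (riffle_shuffle n m) \<sigma> = density_ratio n m \<sigma> / fact n"
    using pmf_riffle_shuffle_density[OF n _ _ \<sigma>] by simp
  moreover have "?\<rho> \<le> density_ratio n m \<sigma>"
    by (rule density_ratio_ge[OF n m]) (use G in auto)
  ultimately show "?\<rho> * pmf (uniform_perm n) \<sigma> \<le> pmf (riffle_shuffle n m) \<sigma>"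
    using \<sigma> by (simp add: pmf_uniform_perm divide_right_mono)
qed

lemma tv_dist_riffle_shuffle_ge:
  assumes n: "n \<ge> 2" and m: "m > 0" and K: "K > 0"
  shows "1 - 1 / K\<^sup>2 - exp (K * (real n * sqrt n / real m) -
      (real n * sqrt n)\<^sup>2 / (32 * real m * (real m + real n)))
    \<le> tv_dist (riffle_shuffle n m) (uniform_perm n)"
    (is "1 - _ - ?\<rho> \<le> _")
proof (rule tv_dist_ge_of_pmf_le)
  let ?G = "{\<sigma>. \<bar>rising_deficit n \<sigma>\<bar> \<le> K * sqrt n}"
  have n1: "n \<ge> 1" using n by simp
  show "finite (set_pmf (riffle_shuffle n m))"
    by (rule finite_subset[OF set_pmf_riffle_shuffle[OF m]]) (simp add: finite_permutations)
  show "0 \<le> ?\<rho>" by simp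
  have "- ?G = {\<sigma>. \<bar>rising_deficit n \<sigma>\<bar> > K * sqrt n}" by auto
  with uniform_perm_chebyshev[OF n1 K]
  show "measure_pmf.prob (uniform_perm n) (- ?G) \<le> 1 / K\<^sup>2" by simp
  fix \<sigma> assume G: "\<sigma> \<in> ?G" and "\<sigma> \<in> set_pmf (riffle_shuffle n m)"
  with set_pmf_riffle_shuffle[OF m] have \<sigma>: "\<sigma> permutes {1..n}" by auto
  show "pmf (riffle_shuffle n m) \<sigma> \<le> ?\<rho> * pmf (uniform_perm n) \<sigma>"
  proof (cases "rising_sequences n \<sigma> \<le> m")
    case True
    have "density_ratio n m \<sigma> \<le> ?\<rho>"
      by (rule density_ratio_le[OF n m True]) (use G in auto)
    then show ?thesis using \<sigma>
      by (simp add: pmf_riffle_shuffle_density[OF n1 m True \<sigma>] pmf_uniform_perm divide_right_mono)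
  next
    case False
    then show ?thesis using pmf_riffle_shuffle_zero[OF n1 m, of \<sigma>] by simp
  qed
qed

section \<open>The cutoff\<close>

text \<open>
  The good set allows a rising deficit of \<open>K * sqrt n\<close>. Taking \<open>K = exp (c / 2)\<close> makes the exceptional
  probability \<open>1 / K\<^sup>2\<close> small while the linear term of the log-density stays below
  \<open>K * exp (- c) = exp (- c / 2)\<close>.
\<close>

lemma tv_dist_above_cutoff:
  assumes c: "c > 0" and n: "n \<ge> 4" and m: "exp c * (real n * sqrt n) \<le> real m"
  shows "tv_dist (riffle_shuffle n m) (uniform_perm n) \<le>
    exp (- c) + 1 - exp (- exp (- c / 2) - 2 * exp (- 2 * c))"
proof -
  define y where "y = real n * sqrt n / real m"
  have s: "real n * sqrt n > 0" using n by simp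
  have m0: "real m > 0" using m s by (smt (verit) exp_gt_zero mult_pos_pos)
  have y0: "y \<ge> 0" by (simp add: y_def)
  have y: "y \<le> exp (- c)" using m m0 by (simp add: y_def exp_minus field_simps)
  have "sqrt 4 \<le> sqrt (real n)" using n by (subst real_sqrt_le_iff) simp
  then have "2 * real n \<le> real n * sqrt n" using n by simp
  also have "\<dots> \<le> exp c * (real n * sqrt n)"
    using mult_right_mono[of 1 "exp c" "real n * sqrt n"] c s by simp
  finally have "2 * n \<le> m" using m by linarith
  then have "tv_dist (riffle_shuffle n m) (uniform_perm n) \<le>
      1 / (exp (c / 2))\<^sup>2 + 1 - exp (- exp (c / 2) * y - 2 * y\<^sup>2)"
    unfolding y_def using n by (intro tv_dist_riffle_shuffle_le) auto
  also have "1 / (exp (c / 2))\<^sup>2 = exp (- c)"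
    using exp_double[of "c / 2"] by (simp add: exp_minus inverse_eq_divide)
  also have "exp (- c) + 1 - exp (- exp (c / 2) * y - 2 * y\<^sup>2) \<le>
      exp (- c) + 1 - exp (- exp (- c / 2) - 2 * exp (- 2 * c))"
  proof -
    have "exp (c / 2) * y \<le> exp (c / 2) * exp (- c)" using y by simp
    also have "\<dots> = exp (- c / 2)" by (simp flip: exp_add)
    finally have "exp (c / 2) * y \<le> exp (- c / 2)" .
    moreover have "y\<^sup>2 \<le> (exp (- c))\<^sup>2" using y y0 by (intro power_mono) auto
    moreover have "(exp (- c))\<^sup>2 = exp (- 2 * c)"
      using exp_double[of "- c"] by simp
    ultimately show ?thesis by simp
  qed
  finally show ?thesis .
qed

text \<open>
  Here the quadratic gain is at least the ratio of \<open>n * sqrt n\<close> to \<open>m\<close> times \<open>exp (- c) / 64\<close>. Choosing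
  \<open>K = exp (- c) / 128\<close> spends half of it on the linear term and still makes \<open>1 / K\<^sup>2\<close>, which is
  \<open>16384 * exp (2 * c)\<close>, vanish as \<open>c\<close> tends to minus infinity.
\<close>

lemma tv_dist_below_cutoff:
  assumes n: "n \<ge> 2" and cn: "exp (- c) \<le> sqrt n"
    and m0: "m > 0" and m: "real m \<le> exp c * (real n * sqrt n)"
  shows "1 - 16384 * exp (2 * c) - exp (- exp (- 2 * c) / 128) \<le>
    tv_dist (riffle_shuffle n m) (uniform_perm n)"
proof -
  define s where "s = real n * sqrt n"
  define K where "K = exp (- c) / 128"
  have s: "s > 0" using n by (simp add: s_def)
  have y: "exp (- c) \<le> s / real m"
    using m m0 by (simp add: s_def exp_minus field_simps)
  have "1 \<le> exp c * sqrt n" using cn by (simp add: exp_minus field_simps)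
  then have "real n \<le> exp c * s"
    using mult_left_mono[of 1 "exp c * sqrt n" "real n"] by (simp add: s_def mult_ac)
  then have "exp (- c) / 2 \<le> s / (real m + real n)"
    using m m0 by (simp add: s_def exp_minus field_simps)
  then have "s / real m * (exp (- c) / 2) / 32 \<le> s / real m * (s / (real m + real n)) / 32"
    using s by (intro mult_left_mono divide_right_mono) auto
  also have "\<dots> = s\<^sup>2 / (32 * real m * (real m + real n))"
    by (simp add: power2_eq_square)
  finally have "K * (s / real m) - s\<^sup>2 / (32 * real m * (real m + real n)) \<le>
      K * (s / real m) - s / real m * (exp (- c) / 2) / 32"
    by simp
  also have "\<dots> = - (s / real m * exp (- c) / 128)" by (simp add: K_def field_simps)
  also have "\<dots> \<le> - (exp (- c) * exp (- c) / 128)"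
    using y by (intro le_imp_neg_le divide_right_mono mult_right_mono) auto
  also have "\<dots> = - exp (- 2 * c) / 128" by (simp flip: exp_add)
  finally have expo: "exp (K * (s / real m) - s\<^sup>2 / (32 * real m * (real m + real n))) \<le>
      exp (- exp (- 2 * c) / 128)" by simp
  have "1 / K\<^sup>2 = 16384 * exp (2 * c)"
    using exp_double[of c]
    by (simp add: K_def power_divide exp_minus power_inverse inverse_eq_divide)
  moreover have "K > 0" by (simp add: K_def)
  ultimately show ?thesis
    using tv_dist_riffle_shuffle_ge[OF n m0 \<open>K > 0\<close>, folded s_def] expo by linarith
qed

text \<open>
  The time \<open>t n + c / \<mu> n\<close> is the one at which \<open>m n\<close> raised to it equals \<open>exp c * n * sqrt n\<close>.
  Rounding away from \<open>t n\<close> keeps the number of packs on the favourable side of this value, so the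
  two preceding bounds apply for each \<open>c\<close> without any restriction on the growth of \<open>m n\<close>.
\<close>

theorem theorem3p1:
  fixes m :: "nat \<Rightarrow> nat" and \<mu> t :: "nat \<Rightarrow> real"
  assumes "\<And>n. n \<ge> 1 \<Longrightarrow> m n > 1"
    and "\<And>n. n \<ge> 1 \<Longrightarrow> \<mu> n = ln (real (m n))"
    and "\<And>n. n \<ge> 1 \<Longrightarrow> t n = 3 * ln (real n) / (2 * \<mu> n)"
  shows "presents_tv_cutoff (\<lambda>n. riffle_shuffle n (m n)) t (\<lambda>n. inverse (\<mu> n))"
proof -
  have \<mu>: "\<mu> n > 0" if "n \<ge> 1" for n using assms(1,2)[OF that] by simp
  let ?k = "\<lambda>c n. cutoff_time (t n) (inverse (\<mu> n)) c"
  let ?tv = "\<lambda>c n. tv_dist (convolution_power (riffle_shuffle n (m n)) (?k c n)) (uniform_perm n)"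
  have tv: "?tv c n = tv_dist (riffle_shuffle n (m n ^ ?k c n)) (uniform_perm n)" if "n \<ge> 1" for c n
    using assms(1)[OF that] by (simp add: convolution_power_riffle_shuffle)
  have pow: "real (m n ^ k) = exp (real k * \<mu> n)" if "n \<ge> 1" for n k
    using assms(1,2)[OF that] by (simp add: exp_of_nat_mult)
  have time: "exp ((t n + c * inverse (\<mu> n)) * \<mu> n) = exp c * (real n * sqrt n)" if "n \<ge> 1" for n c
  proof -
    have "(t n + c * inverse (\<mu> n)) * \<mu> n = c + (ln (real n) + ln (sqrt n))"
      using \<mu>[OF that] that by (simp add: assms(3)[OF that] ln_sqrt field_simps)
    then show ?thesis using that by (simp add: exp_add)
  qed
  have upper: "?tv c n \<le> exp (- c) + 1 - exp (- exp (- c / 2) - 2 * exp (- 2 * c))"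
    if c: "c > 0" and n: "n \<ge> 4" for c n
  proof -
    have n1: "n \<ge> 1" using n by simp
    have "t n + c * inverse (\<mu> n) \<le> real (?k c n)"
      unfolding cutoff_time_def using c by (simp only: if_True) (rule real_nat_ceiling_ge)
    then have "exp ((t n + c * inverse (\<mu> n)) * \<mu> n) \<le> exp (real (?k c n) * \<mu> n)"
      using \<mu>[OF n1] by simp
    then show ?thesis
      unfolding tv[OF n1] time[OF n1] pow[OF n1, symmetric]
      by (rule tv_dist_above_cutoff[OF c n])
  qed
  have lower: "1 - 16384 * exp (2 * c) - exp (- exp (- 2 * c) / 128) \<le> ?tv c n"
    if c: "c < 0" and n: "n \<ge> 2" and cn: "exp (- c) \<le> sqrt n" for c n
  proof -
    have n1: "n \<ge> 1" using n by simp
    (* The rounded time must be a genuine natural number: truncation of a negative time at 0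
       would round it upwards. *)
    have "exp 0 \<le> exp c * sqrt n" using cn by (simp add: exp_minus field_simps)
    also have "\<dots> \<le> exp c * (real n * sqrt n)" using n by simp
    finally have "exp 0 \<le> exp ((t n + c * inverse (\<mu> n)) * \<mu> n)" by (simp add: time[OF n1])
    then have "0 \<le> t n + c * inverse (\<mu> n)"
      using \<mu>[OF n1] unfolding exp_le_cancel_iff by (simp add: zero_le_mult_iff)
    then have "real (?k c n) \<le> t n + c * inverse (\<mu> n)" using c by (simp add: cutoff_time_def)
    then have "exp (real (?k c n) * \<mu> n) \<le> exp ((t n + c * inverse (\<mu> n)) * \<mu> n)"
      using \<mu>[OF n1] by simp
    then show ?thesis
      unfolding tv[OF n1] time[OF n1] pow[OF n1, symmetric]
      by (intro tv_dist_below_cutoff[OF n cn]) (use assms(1)[OF n1] in auto)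
  qed
  show ?thesis
    unfolding presents_tv_cutoff_def
  proof (intro conjI)
    show "\<forall>\<^sub>F n in sequentially. t n > 0"
      using eventually_ge_at_top[of 2]
    proof eventually_elim
      case (elim n)
      then show ?case using \<mu>[of n] by (simp add: assms(3))
    qed
    have "\<forall>\<^sub>F n in sequentially. 2 / (3 * ln (real n)) = inverse (\<mu> n) / t n"
      using eventually_ge_at_top[of 1]
    proof eventually_elim
      case (elim n)
      then show ?case using \<mu>[of n] by (simp add: assms(3) field_simps)
    qed
    moreover have "(\<lambda>n. 2 / (3 * ln (real n))) \<longlonglongrightarrow> 0" by real_asymp
    ultimately show "(\<lambda>n. inverse (\<mu> n) / t n) \<longlonglongrightarrow> 0"
      by (rule Lim_transform_eventually[rotated])
  next
    show "((\<lambda>c. limsup (\<lambda>n. ereal (?tv c n))) \<longlongrightarrow> 0) at_top"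
    proof (rule tendsto_sandwich)
      show "\<forall>\<^sub>F c in at_top. 0 \<le> limsup (\<lambda>n. ereal (?tv c n))"
        by (intro always_eventually allI le_Limsup) (auto simp: tv_dist_nonneg)
      show "\<forall>\<^sub>F c in at_top. limsup (\<lambda>n. ereal (?tv c n)) \<le>
          ereal (exp (- c) + 1 - exp (- exp (- c / 2) - 2 * exp (- 2 * c)))"
        using eventually_gt_at_top[of 0]
      proof eventually_elim
        case (elim c)
        show ?case
          by (intro Limsup_bounded eventually_mono[OF eventually_ge_at_top[of 4]])
            (use upper[OF elim] in simp)
      qed
      have "((\<lambda>c::real. exp (- c) + 1 - exp (- exp (- c / 2) - 2 * exp (- 2 * c))) \<longlongrightarrow> 0) at_top"
        by real_asymp
      then show "((\<lambda>c. ereal (exp (- c) + 1 - exp (- exp (- c / 2) - 2 * exp (- 2 * c)))) \<longlongrightarrow> 0) at_top"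
        by (simp add: zero_ereal_def)
    qed simp
    show "((\<lambda>c. liminf (\<lambda>n. ereal (?tv c n))) \<longlongrightarrow> 1) at_bot"
    proof (rule tendsto_sandwich)
      show "\<forall>\<^sub>F c in at_bot. ereal (1 - 16384 * exp (2 * c) - exp (- exp (- 2 * c) / 128)) \<le>
          liminf (\<lambda>n. ereal (?tv c n))"
        using eventually_gt_at_bot[of 0]
      proof eventually_elim
        case (elim c)
        have "\<forall>\<^sub>F n in sequentially. exp (- c) \<le> sqrt (real n)" by real_asymp
        then have "\<forall>\<^sub>F n in sequentially. n \<ge> 2 \<and> exp (- c) \<le> sqrt (real n)"
          using eventually_ge_at_top by (rule eventually_conj[rotated])
        then show ?case
          by (intro Liminf_bounded, elim eventually_mono) (use lower[OF elim] in simp)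
      qed
      show "\<forall>\<^sub>F c in at_bot. liminf (\<lambda>n. ereal (?tv c n)) \<le> 1"
        by (intro always_eventually allI Liminf_le) (auto simp: tv_dist_le_1)
      have "((\<lambda>c::real. 1 - 16384 * exp (2 * c) - exp (- exp (- 2 * c) / 128)) \<longlongrightarrow> 1) at_bot"
        by real_asymp
      then show "((\<lambda>c. ereal (1 - 16384 * exp (2 * c) - exp (- exp (- 2 * c) / 128))) \<longlongrightarrow> 1) at_bot"
        by (simp add: one_ereal_def)
    qed simp
  qed
qed

end
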